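(* Let $(X_t)_{t\in\mathbb Z}$ be an $\mathbb R^d$-valued strictly stationary sequence which is regularly varying with index $\alpha>0$ and has spectral tail process $(\Theta_t)_{t\in\mathbb Z}$. Assume that $X_t=f(\Phi_t)$, $t\in\mathbb Z$, where $f$ is an $\mathbb R^d$-valued function acting on the state space of a Markov chain $(\Phi_t)$ and the drift condition $(\mathrm{DC}_p)$ holds for some positive $p\in(\alpha-1,\alpha)$. Then for every $\theta\in\mathbb S^{d-1}$ the limit $b(\theta)=\lim_{k\to\infty}(b_{k+1}(\theta)-b_k(\theta))$ exists, is finite, and equals $$b(\theta)=\mathbb E\Big[\Big(\sum_{t\ge 0}\theta'\Theta_t\Big)_+^\alpha-\Big(\sum_{t\ge 1}\theta'\Theta_t\Big)_+^\alpha\Big].$$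
   Context: $|\cdot|$ is the Euclidean norm, $\mathbb S^{d-1}$ the unit sphere of $\mathbb R^d$, $\theta'$ denotes transpose, $x_+=\max(x,0)$, $X$ denotes a generic element of $(X_t)$. Regular variation: a random vector $Z$ in $\mathbb R^m$ is regularly varying with index $\alpha>0$ if there is a random vector $\Theta$ on the unit sphere such that for all $u>0$, $\mathbb P(|Z|>ux,\,Z/|Z|\in\cdot)/\mathbb P(|Z|>x)$ converges weakly to $u^{-\alpha}\mathbb P(\Theta\in\cdot)$ as $x\to\infty$. A strictly stationary sequence $(X_t)$ is regularly varying with index $\alpha$ if $(X_1,\dots,X_k)$ is regularly varying with index $\alpha$ for every $k\ge1$. Spectral tail process: the process $(\Theta_t)_{t\in\mathbb Z}$ such that for every $k\ge0$, the conditional law of $|X_0|^{-1}(X_{-k},\dots,X_k)$ given $|X_0|>x$ converges weakly, as $x\to\infty$, to the law of $(\Theta_{-k},\dots,\Theta_k)$ (it exists for every regularly varying stationary sequence; $|\Theta_0|=1$ a.s.). With $S_k=X_1+\cdots+X_k$, set $b_k(\theta)=\lim_{x\to\infty}\mathbb P(\theta'S_k>x)/\mathbb P(|X|>x)$, $k\ge1$, $\theta\in\mathbb S^{d-1}$ (these limits exist by regular variation). Drift condition $(\mathrm{DC}_p)$, $p>0$: there exist constants $\beta\in(0,1)$, $b_0>0$ and a function $V:\mathbb R^d\to[0,\infty)$ with $c_1|x|^p\le V(x)\le c_2|x|^p$ for all $x\in\mathbb{R}^d$, for some $c_1,c_2>0$, such that for every $y$ in the state space of the Markov chain $$\mathbb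 E\big(V(f(\Phi_1))\mid\Phi_0=y\big)\le\beta V(f(y))+b_0.$$ Standing assumption: there is $M>0$ such that $\{x: V(f(x))\le M\}$ is a small set for the chain (a set $C$ is small if there are $m\ge1$ and a nonzero measure $\nu$ with $P^m(x,\cdot)\ge\nu(\cdot)$ for all $x\in C$, $P$ being the transition kernel). *)

theory Defs
  imports "HOL-Probability.Probability"
begin

text \<open>
  Finite families \<open>(z\<^sub>i)\<^sub>i\<^sub>\<in>\<^sub>I\<close> of vectors of a Euclidean space \<open>'a\<close> (which plays the role of \<open>\<real>\<^sup>d\<close>),
  i.e. elements of \<open>\<real>\<^sup>d\<^sup>|\<^sup>I\<^sup>|\<close>, are encoded as functions \<open>int \<Rightarrow> 'a\<close> that vanish outside \<open>I\<close>.
  For finite \<open>I\<close> the product topology of \<open>int \<Rightarrow> 'a\<close> restricts to the Euclidean topology on this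
  (closed) set, so weak convergence may be tested with bounded continuous functions on
  \<open>int \<Rightarrow> 'a\<close>.
\<close>

definition family_vec :: "int set \<Rightarrow> (int \<Rightarrow> 'a::euclidean_space) \<Rightarrow> int \<Rightarrow> 'a"
  where "family_vec I z = (\<lambda>i. if i \<in> I then z i else 0)"

definition family_norm :: "int set \<Rightarrow> (int \<Rightarrow> 'a::euclidean_space) \<Rightarrow> real"
  where "family_norm I z = L2_set (\<lambda>i. norm (z i)) I"

definition family_sphere :: "int set \<Rightarrow> (int \<Rightarrow> 'a::euclidean_space) set"
  where "family_sphere I = {z. family_vec I z = z \<and> family_norm I z = 1}"

text \<open>Weak convergence of finite Borel measures.\<close>

definition weakly_tendsto ::
    "('i \<Rightarrow> 'b::topological_space measure) \<Rightarrow> 'b measure \<Rightarrow> 'i filter \<Rightarrow> bool"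
  where "weakly_tendsto \<mu> \<nu> F \<longleftrightarrow>
    (\<forall>g::'b \<Rightarrow> real. continuous_on UNIV g \<and> bounded (range g) \<longrightarrow>
       ((\<lambda>x. \<integral>z. g z \<partial>\<mu> x) \<longlongrightarrow> (\<integral>z. g z \<partial>\<nu>)) F)"

text \<open>
  For \<open>Z = (Y\<^sub>i)\<^sub>i\<^sub>\<in>\<^sub>I\<close>, the measure \<open>P(|Z| > u x, Z/|Z| \<in> \<cdot>) / P(|Z| > x)\<close>. It is the null measure
  if \<open>P(|Z| > x) = 0\<close>; since the limit required below has positive mass, regular variation
  therefore forces \<open>P(|Z| > x) > 0\<close> for all \<open>x\<close>.
\<close>

definition angular_tail ::
    "'w measure \<Rightarrow> int set \<Rightarrow> (int \<Rightarrow> 'w \<Rightarrow> 'a::euclidean_space) \<Rightarrow> real \<Rightarrow> real \<Rightarrow> (int \<Rightarrow> 'a) measure"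
  where "angular_tail M I Y u x =
    scale_measure (ennreal (1 / measure M {w \<in> space M. family_norm I (\<lambda>i. Y i w) > x}))
      (distr (density M (indicator {w \<in> space M. family_norm I (\<lambda>i. Y i w) > u * x})) borel
        (\<lambda>w. family_vec I (\<lambda>i. Y i w /\<^sub>R family_norm I (\<lambda>j. Y j w))))"

text \<open>\<open>Q\<close> is the law of the random vector \<open>\<Theta>\<close> on the unit sphere.\<close>

definition regularly_varying_vec ::
    "'w measure \<Rightarrow> int set \<Rightarrow> (int \<Rightarrow> 'w \<Rightarrow> 'a::euclidean_space) \<Rightarrow> real \<Rightarrow> bool"
  where "regularly_varying_vec M I Y \<alpha> \<longleftrightarrow>
    \<alpha> > 0 \<and> (\<forall>i\<in>I. Y i \<in> borel_measurable M) \<and>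
    (\<exists>Q. prob_space Q \<and> sets Q = sets borel \<and> (AE z in Q. z \<in> family_sphere I) \<and>
      (\<forall>u>0. weakly_tendsto (angular_tail M I Y u)
               (scale_measure (ennreal (u powr (- \<alpha>))) Q) at_top))"

definition strictly_stationary :: "'w measure \<Rightarrow> (int \<Rightarrow> 'w \<Rightarrow> 'a::euclidean_space) \<Rightarrow> bool"
  where "strictly_stationary M X \<longleftrightarrow>
    (\<forall>t. X t \<in> borel_measurable M) \<and>
    (\<forall>h. distr M (\<Pi>\<^sub>M t\<in>UNIV. borel) (\<lambda>w t. X (t + h) w)
       = distr M (\<Pi>\<^sub>M t\<in>UNIV. borel) (\<lambda>w t. X t w))"

definition regularly_varying_seq ::
    "'w measure \<Rightarrow> (int \<Rightarrow> 'w \<Rightarrow> 'a::euclidean_space) \<Rightarrow> real \<Rightarrow> bool"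
  where "regularly_varying_seq M X \<alpha> \<longleftrightarrow>
    (\<forall>k::nat. k \<ge> 1 \<longrightarrow> regularly_varying_vec M {1..int k} X \<alpha>)"

text \<open>
  The process \<open>\<Theta>\<close> lives on its own probability space \<open>N\<close>. The conditional law given an event
  \<open>A\<close> is the image of \<open>uniform_measure M A\<close>.
\<close>

definition spectral_tail_process ::
    "'w measure \<Rightarrow> (int \<Rightarrow> 'w \<Rightarrow> 'a::euclidean_space) \<Rightarrow> 'v measure \<Rightarrow> (int \<Rightarrow> 'v \<Rightarrow> 'a) \<Rightarrow> bool"
  where "spectral_tail_process M X N \<Theta> \<longleftrightarrow>
    prob_space N \<and> (\<forall>t. \<Theta> t \<in> borel_measurable N) \<and>
    (\<forall>k::nat. weakly_tendsto
       (\<lambda>x. distr (uniform_measure M {w \<in> space M. norm (X 0 w) > x}) borel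
              (\<lambda>w. family_vec {- int k..int k} (\<lambda>i. X i w /\<^sub>R norm (X 0 w))))
       (distr N borel (\<lambda>v. family_vec {- int k..int k} (\<lambda>i. \<Theta> i v)))
       at_top)"

text \<open>
  The existence of the limit is a consequence of regular variation and not part of the definition.
\<close>

definition tail_limit ::
    "'w measure \<Rightarrow> (int \<Rightarrow> 'w \<Rightarrow> 'a::euclidean_space) \<Rightarrow> nat \<Rightarrow> 'a \<Rightarrow> real"
  where "tail_limit M X k \<theta> =
    Lim at_top (\<lambda>x. measure M {w \<in> space M. \<theta> \<bullet> (\<Sum>i\<in>{1..int k}. X i w) > x}
                     / measure M {w \<in> space M. norm (X 0 w) > x})"

text \<open>
  Time-homogeneous Markov chain, indexed by the integers, with values in the measurable space \<open>S\<close>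
  and transition kernel \<open>K\<close>.
\<close>

definition markov_chain ::
    "'w measure \<Rightarrow> 's measure \<Rightarrow> ('s \<Rightarrow> 's measure) \<Rightarrow> (int \<Rightarrow> 'w \<Rightarrow> 's) \<Rightarrow> bool"
  where "markov_chain M S K \<Phi> \<longleftrightarrow>
    K \<in> measurable S (prob_algebra S) \<and> (\<forall>t. \<Phi> t \<in> measurable M S) \<and>
    (\<forall>t. \<forall>A\<in>sets S. AE w in M.
       real_cond_exp M (sigma (space M) {\<Phi> s -` B \<inter> space M | s B. s \<le> t \<and> B \<in> sets S})
         (\<lambda>w. indicator A (\<Phi> (t + 1) w)) w
       = measure (K (\<Phi> t w)) A)"

primrec kernel_power :: "'s measure \<Rightarrow> ('s \<Rightarrow> 's measure) \<Rightarrow> nat \<Rightarrow> 's \<Rightarrow> 's measure"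
  where
    "kernel_power S K 0 = return S"
  | "kernel_power S K (Suc m) = (\<lambda>x. K x \<bind> kernel_power S K m)"

definition small_set :: "'s measure \<Rightarrow> ('s \<Rightarrow> 's measure) \<Rightarrow> 's set \<Rightarrow> bool"
  where "small_set S K C \<longleftrightarrow>
    (\<exists>m\<ge>1. \<exists>\<nu>. sets \<nu> = sets S \<and> emeasure \<nu> (space S) \<noteq> 0 \<and>
       (\<forall>x\<in>C. \<forall>A\<in>sets S. emeasure \<nu> A \<le> emeasure (kernel_power S K m x) A))"

text \<open>
  The condition \<open>(DC\<^sub>p)\<close> with the Lyapunov function \<open>V\<close>;
  \<open>E(V(f(\<Phi>\<^sub>1)) | \<Phi>\<^sub>0 = y)\<close> is the integral of \<open>V \<circ> f\<close> with respect to \<open>K y\<close>.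
\<close>

definition drift_condition ::
    "'s measure \<Rightarrow> ('s \<Rightarrow> 's measure) \<Rightarrow> ('s \<Rightarrow> 'a::euclidean_space) \<Rightarrow> real \<Rightarrow> ('a \<Rightarrow> real) \<Rightarrow> bool"
  where "drift_condition S K f p V \<longleftrightarrow>
    p > 0 \<and> V \<in> borel_measurable borel \<and> (\<forall>x. V x \<ge> 0) \<and>
    (\<exists>c\<^sub>1>0. \<exists>c\<^sub>2>0. \<forall>x. c\<^sub>1 * norm x powr p \<le> V x \<and> V x \<le> c\<^sub>2 * norm x powr p) \<and>
    (\<exists>\<beta> b\<^sub>0. 0 < \<beta> \<and> \<beta> < 1 \<and> 0 < b\<^sub>0 \<and>
       (\<forall>y\<in>space S. (\<integral>\<^sup>+z. ennreal (V (f z)) \<partial>K y) \<le> ennreal (\<beta> * V (f y) + b\<^sub>0)))"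

end

theory Submission
  imports Defs
begin

text \<open>
  Write \<open>s\<^sub>k\<close> and \<open>s'\<^sub>k\<close> for the sums of \<open>\<theta>'\<Theta>\<^sub>t\<close> over \<open>0 \<le> t \<le> k\<close> and \<open>1 \<le> t \<le> k\<close>. The theorem follows by
  dominated convergence from the identity
  \<open>b\<^sub>k\<^sub>+\<^sub>1(\<theta>) - b\<^sub>k(\<theta>) = E[max 0 s\<^sub>k powr \<alpha> - max 0 s'\<^sub>k powr \<alpha>]\<close> and an integrable bound for the
  integrand that is uniform in \<open>k\<close>.
  
  The identity (\<open>tail_limit_increment\<close>): by stationarity, the increment compares the tails of
  \<open>\<theta>'(X\<^sub>0 + S\<^sub>k)\<close> and \<open>\<theta>'S\<^sub>k\<close> for the same \<open>S\<^sub>k = X\<^sub>1 + \<dots> + X\<^sub>k\<close>. The two events \<open>\<dots> > x\<close> differ, up to a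
  negligible part, only where \<open>|X\<^sub>0|\<close> is of order \<open>x\<close> (\<open>increment_limit\<close>). There \<open>|X\<^sub>0| / x\<close> behaves like a
  Pareto variable \<open>Y\<close> independent of the spectral tail process, which describes the \<open>X\<^sub>t / |X\<^sub>0|\<close>, and
  \<open>Y s > 1\<close> has weight \<open>max 0 s powr \<alpha>\<close> (\<open>tail_of_product\<close>). That the part with small \<open>|X\<^sub>0|\<close> is negligible
  uses that the tail of \<open>\<theta>'S\<^sub>k\<close> is known already, so the limits \<open>b\<^sub>k(\<theta>)\<close> are obtained by induction on \<open>k\<close>.
  
  The bound (\<open>integrable_spectral_envelope\<close>): iterating the drift condition from a large \<open>X\<^sub>0\<close>
  (\<open>weighted_drift\<close>) shows that \<open>E |\<Theta>\<^sub>t|\<^sup>p\<close> decays geometrically in \<open>t\<close>. Hence the sum \<open>Z\<close> of the \<open>|\<Theta>\<^sub>t|\<close>,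
  \<open>t \<ge> 0\<close>, is finite almost surely and has a finite moment of order \<open>p\<close>. Both \<open>s\<^sub>k\<close> and \<open>s'\<^sub>k\<close> are at most \<open>Z\<close> in
  modulus and they differ by at most \<open>|\<Theta>\<^sub>0| \<le> 1\<close>. So the difference of their powers is at most \<open>1\<close> if
  \<open>\<alpha> \<le> 1\<close>, and of order \<open>1 + Z powr (\<alpha> - 1)\<close> if \<open>\<alpha> > 1\<close>, which is integrable because \<open>\<alpha> - 1 < p\<close>
  (\<open>abs_powr_diff_le_envelope\<close>).
\<close>

section \<open>Inequalities for powers and sums\<close>

text \<open>
  For \<open>\<alpha> \<le> 1\<close> the power is subadditive and the difference is at most \<open>1\<close>. For \<open>\<alpha> > 1\<close> the mean
  value theorem gives at most \<open>\<alpha>\<close> times a value of the power \<open>\<alpha> - 1\<close> below \<open>Y\<close>, and this is where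
  \<open>p > \<alpha> - 1\<close> enters. The right-hand side covers both cases.
\<close>

lemma abs_powr_diff_le_envelope:
  fixes a b Y \<alpha> p :: real
  assumes "0 < \<alpha>" "0 < p" "\<alpha> - 1 < p"
    and "0 \<le> a" "0 \<le> b" "a \<le> Y" "b \<le> Y" "\<bar>a - b\<bar> \<le> 1"
  shows "\<bar>a powr \<alpha> - b powr \<alpha>\<bar> \<le> 1 + \<alpha> * (1 + Y powr p)"
proof -
  have *: "a powr \<alpha> - b powr \<alpha> \<le> 1 + \<alpha> * (1 + Y powr p)"
    if ab: "0 \<le> b" "b < a" "a \<le> Y" "a - b \<le> 1" for a b :: real
  proof (cases "\<alpha> \<le> 1 \<or> b = 0")
    case True
    have a0: "0 < a" using ab by simp
    have "a powr \<alpha> \<le> b powr \<alpha> + (a - b) powr \<alpha>"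
    proof (cases "b = 0")
      case False
      with True have "\<alpha> \<le> 1" by simp
      then have *: "t \<le> t powr \<alpha>" if "0 \<le> t" "t \<le> 1" for t :: real
        using powr_mono'[of \<alpha> 1 t] that by simp
      \<comment> \<open>A number in the unit interval is at most its power with exponent \<open>\<alpha> \<le> 1\<close>;
          this gives subadditivity after scaling by \<open>a\<close>.\<close>
      have "1 = b / a + (a - b) / a"
        using a0 by (simp add: field_simps)
      also have "\<dots> \<le> (b / a) powr \<alpha> + ((a - b) / a) powr \<alpha>"
        using ab a0 by (intro add_mono *) (auto simp: field_simps)
      also have "\<dots> = (b powr \<alpha> + (a - b) powr \<alpha>) / a powr \<alpha>"
        using ab by (simp add: powr_divide add_divide_distrib)
      finally show ?thesis
        using a0 by (simp add: field_simps)
    qed simp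
    moreover have "(a - b) powr \<alpha> \<le> 1"
      using ab assms(1) by (intro powr_le1) auto
    moreover have "0 \<le> \<alpha> * (1 + Y powr p)"
      using assms(1) by simp
    ultimately show ?thesis by linarith
  next
    case False
    have "\<exists>z>b. z < a \<and> a powr \<alpha> - b powr \<alpha> = (a - b) * (\<alpha> * z powr (\<alpha> - 1))"
      by (rule MVT2) (use ab False in \<open>auto intro!: derivative_eq_intros\<close>)
    then obtain z where z: "b < z" "z < a"
      "a powr \<alpha> - b powr \<alpha> = (a - b) * (\<alpha> * z powr (\<alpha> - 1))" by auto
    have "z powr (\<alpha> - 1) \<le> 1 + Y powr p"
    proof (cases "z \<le> 1")
      case True
      have "z powr (\<alpha> - 1) \<le> 1"
        using True z ab False by (intro powr_le1) auto
      then show ?thesis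
        by (simp add: add_increasing2)
    next
      case z1: False
      have "z powr (\<alpha> - 1) \<le> z powr p"
        using z1 assms by (intro powr_mono) auto
      also have "\<dots> \<le> Y powr p"
        using z1 assms z ab by (intro powr_mono2) auto
      finally show ?thesis by simp
    qed
    then have "(a - b) * (\<alpha> * z powr (\<alpha> - 1)) \<le> 1 * (\<alpha> * (1 + Y powr p))"
      using ab assms(1) by (intro mult_mono) auto
    then show ?thesis
      using z(3) by simp
  qed
  have "0 \<le> 1 + \<alpha> * (1 + Y powr p)"
    using assms(1) by simp
  then show ?thesis
    using *[of a b] *[of b a] powr_mono2[of \<alpha> a b] powr_mono2[of \<alpha> b a] assms
    by (cases a b rule: linorder_cases) (auto simp: abs_le_iff)
qed

text \<open>
  Each summand of the weighted series is at most its sum \<open>G\<close>, so the \<open>a t\<close> decay geometrically with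
  a constant of order \<open>G\<close> to the power \<open>1 / p\<close>. Bounding \<open>a\<close> by its largest rescaled term in this way
  works for all \<open>p > 0\<close> alike; subadditivity (\<open>p \<le> 1\<close>) and the Minkowski inequality (\<open>p \<ge> 1\<close>) would
  have to be distinguished otherwise.
\<close>

lemma sum_powr_le_of_weighted_powers:
  fixes a :: "nat \<Rightarrow> real" and r p G :: real
  assumes r: "0 < r" "r < 1" and p: "0 < p"
    and sm: "(\<Sum>t. ennreal (r powr (- real t) * \<bar>a t\<bar> powr p)) = ennreal G" and G: "0 \<le> G"
  shows "summable (\<lambda>t. \<bar>a t\<bar>)"
    and "(\<Sum>t. \<bar>a t\<bar>) powr p \<le> G / (1 - r powr (1 / p)) powr p"
proof -
  define \<rho> where "\<rho> = r powr (1 / p)"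
  have \<rho>: "0 < \<rho>" "\<rho> < 1"
    using r p powr_less_mono2[of "1 / p" r 1] by (simp_all add: \<rho>_def)
  have bd: "\<bar>a t\<bar> \<le> G powr (1 / p) * \<rho> ^ t" for t
  proof -
    have "g t \<le> (\<Sum>t. g t)" for g :: "nat \<Rightarrow> ennreal"
      using sum_le_suminf[OF summableI, of "{t}" g] by simp
    from this[of "\<lambda>t. ennreal (r powr (- real t) * \<bar>a t\<bar> powr p)"] have "r powr (- real t) * \<bar>a t\<bar> powr p \<le> G"
      using G unfolding sm by simp
    then have "\<bar>a t\<bar> powr p \<le> G * r powr real t"
      using r by (simp add: powr_minus field_simps)
    then have "(\<bar>a t\<bar> powr p) powr (1 / p) \<le> (G * r powr real t) powr (1 / p)"
      using p by (intro powr_mono2) auto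
    also have "(\<bar>a t\<bar> powr p) powr (1 / p) = \<bar>a t\<bar>"
      using p by (simp add: powr_powr)
    also have "(G * r powr real t) powr (1 / p) = G powr (1 / p) * \<rho> ^ t"
      using r G \<rho> by (simp add: powr_mult powr_powr \<rho>_def flip: powr_realpow)
    finally show ?thesis .
  qed
  have geo: "summable (\<lambda>t. G powr (1 / p) * \<rho> ^ t)"
    using \<rho> by (intro summable_mult summable_geometric) auto
  show sm: "summable (\<lambda>t. \<bar>a t\<bar>)"
    by (rule summable_comparison_test'[OF geo, of 0]) (use bd in auto)
  have "(\<Sum>t. \<bar>a t\<bar>) \<le> (\<Sum>t. G powr (1 / p) * \<rho> ^ t)"
    by (intro suminf_le sm geo bd)
  also have "\<dots> = G powr (1 / p) / (1 - \<rho>)"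
    using \<rho> by (subst suminf_mult) (auto simp: suminf_geometric)
  finally have "(\<Sum>t. \<bar>a t\<bar>) powr p \<le> (G powr (1 / p) / (1 - \<rho>)) powr p"
    using p sm by (intro powr_mono2 suminf_nonneg) auto
  also have "\<dots> = G / (1 - \<rho>) powr p"
    using p G \<rho> by (simp add: powr_divide powr_powr)
  finally show "(\<Sum>t. \<bar>a t\<bar>) powr p \<le> G / (1 - r powr (1 / p)) powr p"
    by (simp add: \<rho>_def)
qed

section \<open>Tails of products\<close>

text \<open>
  The bounds \<open>lo n\<close> and \<open>hi n\<close> take a limit in \<open>x\<close> for each fixed precision \<open>n\<close>; these limits need
  only be controlled, by \<open>l'\<close> and \<open>u'\<close>, as the precision grows.
\<close>

lemma tendsto_by_approximation:
  fixes h :: "'x \<Rightarrow> real" and lo hi :: "nat \<Rightarrow> 'x \<Rightarrow> real"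
  assumes "\<forall>\<^sub>F n in sequentially. (lo n \<longlongrightarrow> l n) F \<and> (hi n \<longlongrightarrow> u n) F \<and> l' n \<le> l n \<and> u n \<le> u' n
       \<and> (\<forall>\<^sub>F x in F. lo n x \<le> h x \<and> h x \<le> hi n x)"
    and "l' \<longlonglongrightarrow> L" "u' \<longlonglongrightarrow> L"
  shows "(h \<longlongrightarrow> L) F"
proof (rule order_tendstoI)
  fix a assume "a < L"
  then have "\<forall>\<^sub>F n in sequentially. a < l' n"
    by (rule order_tendstoD(1)[OF assms(2)])
  from eventually_happens'[OF sequentially_bot eventually_conj[OF assms(1) this]] obtain n where n: "a < l' n" "(lo n \<longlongrightarrow> l n) F" "l' n \<le> l n"
      "\<forall>\<^sub>F x in F. lo n x \<le> h x \<and> h x \<le> hi n x"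
    by blast
  then have "\<forall>\<^sub>F x in F. a < lo n x"
    by (intro order_tendstoD(1)[OF n(2)]) auto
  with n(4) show "\<forall>\<^sub>F x in F. a < h x"
    by eventually_elim auto
next
  fix a assume "a > L"
  then have "\<forall>\<^sub>F n in sequentially. a > u' n"
    by (rule order_tendstoD(2)[OF assms(3)])
  from eventually_happens'[OF sequentially_bot eventually_conj[OF assms(1) this]] obtain n where n: "a > u' n" "(hi n \<longlongrightarrow> u n) F" "u' n \<ge> u n"
      "\<forall>\<^sub>F x in F. lo n x \<le> h x \<and> h x \<le> hi n x"
    by blast
  then have "\<forall>\<^sub>F x in F. a > hi n x"
    by (intro order_tendstoD(2)[OF n(2)]) auto
  with n(4) show "\<forall>\<^sub>F x in F. a > h x"
    by eventually_elim auto
qed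

text \<open>
  The hat functions form a continuous partition of unity with mesh \<open>1\<close>. As differences of shifted
  ramps they sum to one by telescoping.
\<close>

definition ramp :: "real \<Rightarrow> real" where "ramp s = min 1 (max 0 s)"

definition hat :: "nat \<Rightarrow> real \<Rightarrow> real" where "hat j s = ramp (s + 1 - real j) - ramp (s - real j)"

lemma hat_nonneg: "0 \<le> hat j s" and hat_le_1: "hat j s \<le> 1"
  by (auto simp: hat_def ramp_def)

lemma hat_eq_0: "s \<le> real j - 1 \<or> real j + 1 \<le> s \<Longrightarrow> hat j s = 0"
  by (auto simp: hat_def ramp_def)

lemma continuous_hat: "continuous_on UNIV (hat j)"
  unfolding hat_def ramp_def by (intro continuous_intros)

lemma sum_hat:
  assumes "0 \<le> s" "s \<le> real m"
  shows "(\<Sum>j\<le>m. hat j s) = 1"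
proof -
  have "(\<Sum>j\<le>m. hat j s) = (\<Sum>j\<le>m. ramp (s + 1 - real j) - ramp (s + 1 - real (Suc j)))"
    by (simp add: hat_def)
  also have "\<dots> = ramp (s + 1 - real 0) - ramp (s + 1 - real (Suc m))"
    by (subst sum_telescope) simp
  also have "\<dots> = 1"
    using assms by (simp add: ramp_def)
  finally show ?thesis .
qed

text \<open>
  A version of Breiman's lemma: given \<open>R > x\<close>, the quotient \<open>R / x\<close> becomes Pareto distributed, \<open>U\<close>
  becomes distributed like \<open>U'\<close>, and the two become independent. The independence comes for free: the
  law of \<open>U\<close> given \<open>R > u x\<close> has the same limit for each \<open>u\<close>. The limiting tail measure of \<open>R / x\<close>
  has mass \<open>r powr (- \<alpha>)\<close> beyond \<open>r\<close>, thus \<open>U' powr \<alpha>\<close> beyond \<open>1 / U'\<close>.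
  
  The event \<open>R U > x\<close> is not a product event. On the part where \<open>U\<close> is near \<open>j d\<close>, cut out by a hat
  function to keep the weak convergence applicable, it lies between \<open>R (j - 1) d > x\<close> and
  \<open>R (j + 1) d > x\<close>; the limits of the resulting bounds differ from the claim by a shift of \<open>U'\<close> by at
  most \<open>2 d\<close>.
\<close>

lemma (in prob_space) tail_of_product:
  fixes R U :: "'a \<Rightarrow> real" and U' :: "'b \<Rightarrow> real" and \<alpha> c :: real
  assumes "0 < \<alpha>" and "prob_space N"
    and R[measurable]: "R \<in> borel_measurable M" and U[measurable]: "U \<in> borel_measurable M"
    and U'[measurable]: "U' \<in> borel_measurable N"
    and R0: "\<And>w. 0 \<le> R w" and U0: "\<And>w. 0 \<le> U w" and Uc: "\<And>w. U w \<le> c"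
    and U'0: "\<And>v. 0 \<le> U' v" and U'c: "\<And>v. U' v \<le> c"
    and tail: "\<And>u. 0 < u \<Longrightarrow>
      ((\<lambda>x. prob {w \<in> space M. u * x < R w} / prob {w \<in> space M. x < R w}) \<longlongrightarrow> u powr (- \<alpha>)) at_top"
    and lim: "\<And>g :: real \<Rightarrow> real. continuous_on UNIV g \<Longrightarrow> bounded (range g) \<Longrightarrow>
      ((\<lambda>x. (\<integral>w. indicator {w \<in> space M. x < R w} w * g (U w) \<partial>M) / prob {w \<in> space M. x < R w})
        \<longlongrightarrow> (\<integral>v. g (U' v) \<partial>N)) at_top"
  shows "((\<lambda>x. prob {w \<in> space M. x < R w * U w} / prob {w \<in> space M. x < R w})
           \<longlongrightarrow> (\<integral>v. U' v powr \<alpha> \<partial>N)) at_top"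
proof -
  interpret N: prob_space N by fact
  define t where "t x = prob {w \<in> space M. x < R w}" for x
  define E where "E r g x = (\<integral>w. indicator {w \<in> space M. x / r < R w} w * g (U w) \<partial>M) / t x"
    for r x :: real and g :: "real \<Rightarrow> real"
  have scaled: "(E r g \<longlongrightarrow> r powr \<alpha> * (\<integral>v. g (U' v) \<partial>N)) at_top"
    if r: "0 < r" and g: "continuous_on UNIV g" "bounded (range g)" for r g
  proof -
    let ?I = "\<lambda>x. \<integral>w. indicator {w \<in> space M. x < R w} w * g (U w) \<partial>M"
    have f: "filterlim (\<lambda>x. x / r) at_top at_top"
      using filterlim_tendsto_pos_mult_at_top[OF tendsto_const, of "1 / r" "\<lambda>x. x" at_top] r
      by (simp add: filterlim_ident)
    have 1: "((\<lambda>x. ?I (x / r) / t (x / r)) \<longlongrightarrow> (\<integral>v. g (U' v) \<partial>N)) at_top"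
      using filterlim_compose[OF lim[OF g] f] by (simp add: t_def)
    have 2: "((\<lambda>x. t (x / r) / t x) \<longlongrightarrow> r powr \<alpha>) at_top"
      using tail[of "1 / r"] r by (simp add: t_def powr_divide powr_minus field_simps)
    have "\<forall>\<^sub>F x in at_top. 0 < t (x / r) / t x"
      using r by (intro order_tendstoD(1)[OF 2]) auto
    then have ev: "\<forall>\<^sub>F x in at_top. t (x / r) / t x * (?I (x / r) / t (x / r)) = E r g x"
      by eventually_elim (auto simp: E_def)
    show ?thesis
      by (rule Lim_transform_eventually[OF tendsto_mult[OF 2 1] ev])
  qed
  have "((\<lambda>x. prob {w \<in> space M. x < R w * U w} / t x) \<longlongrightarrow> (\<integral>v. U' v powr \<alpha> \<partial>N)) at_top"
  proof -
    define d where "d n = 1 / (real n + 1)" for n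
    define m where "m n = nat \<lceil>c / d n\<rceil>" for n
    have d0: "0 < d n" "d n \<le> 1" for n
      by (auto simp: d_def)
    define g where "g n j u = hat j (u / d n)" for n j u
    have gc: "continuous_on UNIV (g n j)" for n j
    proof -
      have "continuous_on UNIV (\<lambda>u. u / d n)"
        using d0[of n] by (intro continuous_intros) auto
      from continuous_on_compose[OF this, of "hat j"] show ?thesis
        unfolding g_def by (auto simp: o_def intro: continuous_on_subset[OF continuous_hat])
    qed
    have gm[measurable]: "g n j \<in> borel_measurable borel" for n j
      by (intro borel_measurable_continuous_onI gc)
    have gb: "bounded (range (g n j))" for n j
      unfolding bounded_iff by (rule exI[of _ 1]) (auto simp: g_def hat_nonneg hat_le_1)
    have g0: "0 \<le> g n j u" and g1: "g n j u \<le> 1" for n j u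
      by (auto simp: g_def hat_nonneg hat_le_1)
    have gz: "g n j u = 0" if "u \<le> (real j - 1) * d n \<or> (real j + 1) * d n \<le> u" for n j u
      unfolding g_def by (rule hat_eq_0) (use that d0[of n] in \<open>auto simp: field_simps\<close>)
    have gs: "(\<Sum>j\<le>m n. g n j u) = 1" if "0 \<le> u" "u \<le> c" for n u
    proof -
      have "u / d n \<le> c / d n"
        using that d0[of n] by (intro divide_right_mono) auto
      also have "\<dots> \<le> real (m n)"
        unfolding m_def by linarith
      finally show ?thesis
        unfolding g_def by (intro sum_hat) (use that d0[of n] in auto)
    qed
    define hi where "hi n x = (\<Sum>j\<le>m n. E ((real j + 1) * d n) (g n j) x)" for n x
    \<comment> \<open>The cells \<open>j < 2\<close> are left out of the lower bound: \<open>(j - 1) d\<close> has to be positive.\<close>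
    define lo where "lo n x = (\<Sum>j\<in>{2..m n}. E ((real j - 1) * d n) (g n j) x)" for n x
    define u where "u n = (\<Sum>j\<le>m n. ((real j + 1) * d n) powr \<alpha> * (\<integral>v. g n j (U' v) \<partial>N))" for n
    define l where "l n = (\<Sum>j\<in>{2..m n}. ((real j - 1) * d n) powr \<alpha> * (\<integral>v. g n j (U' v) \<partial>N))" for n
    have hi_u: "(hi n \<longlongrightarrow> u n) at_top" for n
      unfolding hi_def u_def by (intro tendsto_sum scaled gc gb) (auto simp: d0)
    have lo_l: "(lo n \<longlongrightarrow> l n) at_top" for n
      unfolding lo_def l_def by (intro tendsto_sum scaled gc gb) (auto simp: d0)
    have intg: "integrable N (\<lambda>v. g n j (U' v))" for n j
      by (rule N.integrable_const_bound[of _ 1]) (auto simp: g0 g1)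
    have shrink: "max 0 (U' v - 2 * d n) \<le> c" for n v
      using U'0[of v] U'c[of v] d0[of n] by simp
    have intp: "integrable N (\<lambda>v. (U' v + 2 * d n) powr \<alpha>)"
         "integrable N (\<lambda>v. max 0 (U' v - 2 * d n) powr \<alpha>)" for n
    proof -
      show "integrable N (\<lambda>v. (U' v + 2 * d n) powr \<alpha>)"
        by (rule N.integrable_const_bound[of _ "(c + 2) powr \<alpha>"])
           (use U'0 U'c d0[of n] assms(1) in \<open>auto intro!: AE_I2 powr_mono2 add_mono add_nonneg_nonneg\<close>)
      show "integrable N (\<lambda>v. max 0 (U' v - 2 * d n) powr \<alpha>)"
        by (rule N.integrable_const_bound[of _ "c powr \<alpha>"])
           (use assms(1) shrink[of _ n] in \<open>auto intro!: AE_I2 powr_mono2\<close>)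
    qed
    have up: "u n \<le> (\<integral>v. (U' v + 2 * d n) powr \<alpha> \<partial>N)" for n
    proof -
      have "u n = (\<integral>v. (\<Sum>j\<le>m n. ((real j + 1) * d n) powr \<alpha> * g n j (U' v)) \<partial>N)"
        unfolding u_def using intg by simp
      also have "\<dots> \<le> (\<integral>v. (U' v + 2 * d n) powr \<alpha> \<partial>N)"
      proof (rule integral_mono)
        fix v
        have "(\<Sum>j\<le>m n. ((real j + 1) * d n) powr \<alpha> * g n j (U' v))
            \<le> (\<Sum>j\<le>m n. (U' v + 2 * d n) powr \<alpha> * g n j (U' v))"
        proof (rule sum_mono)
          fix j assume "j \<in> {..m n}"
          show "((real j + 1) * d n) powr \<alpha> * g n j (U' v) \<le> (U' v + 2 * d n) powr \<alpha> * g n j (U' v)"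
          proof (cases "g n j (U' v) = 0")
            case False
            then have "(real j - 1) * d n < U' v"
              using gz[of "U' v" j n] by force
            then show ?thesis
              using d0[of n] assms(1)
              by (intro mult_right_mono powr_mono2 g0) (auto simp: algebra_simps)
          qed simp
        qed
        also have "\<dots> = (U' v + 2 * d n) powr \<alpha>"
          using gs[of "U' v" n] U'0 U'c by (simp flip: sum_distrib_left)
        finally show "(\<Sum>j\<le>m n. ((real j + 1) * d n) powr \<alpha> * g n j (U' v)) \<le> (U' v + 2 * d n) powr \<alpha>" .
      qed (use intg intp in auto)
      finally show ?thesis .
    qed
    have low: "(\<integral>v. max 0 (U' v - 2 * d n) powr \<alpha> \<partial>N) \<le> l n" for n
    proof -
      have "(\<integral>v. max 0 (U' v - 2 * d n) powr \<alpha> \<partial>N)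
          \<le> (\<integral>v. (\<Sum>j\<in>{2..m n}. ((real j - 1) * d n) powr \<alpha> * g n j (U' v)) \<partial>N)"
      proof (rule integral_mono)
        fix v
        have "max 0 (U' v - 2 * d n) powr \<alpha> = (\<Sum>j\<le>m n. max 0 (U' v - 2 * d n) powr \<alpha> * g n j (U' v))"
          using gs[of "U' v" n] U'0 U'c by (simp flip: sum_distrib_left)
        \<comment> \<open>On the omitted cells \<open>U'\<close> is below \<open>2 d\<close>, so that the truncated difference vanishes.\<close>
        also have "\<dots> = (\<Sum>j\<in>{2..m n}. max 0 (U' v - 2 * d n) powr \<alpha> * g n j (U' v))"
        proof (rule sum.mono_neutral_right)
          show "\<forall>j\<in>{..m n} - {2..m n}. max 0 (U' v - 2 * d n) powr \<alpha> * g n j (U' v) = 0"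
          proof
            fix j assume "j \<in> {..m n} - {2..m n}"
            then have "real j + 1 \<le> 2" by auto
            then have "(real j + 1) * d n \<le> 2 * d n"
              using d0[of n] by (intro mult_right_mono) auto
            then show "max 0 (U' v - 2 * d n) powr \<alpha> * g n j (U' v) = 0"
              using gz[of "U' v" j n] by (cases "U' v \<le> 2 * d n") auto
          qed
        qed auto
        also have "\<dots> \<le> (\<Sum>j\<in>{2..m n}. ((real j - 1) * d n) powr \<alpha> * g n j (U' v))"
        proof (rule sum_mono)
          fix j assume j: "j \<in> {2..m n}"
          show "max 0 (U' v - 2 * d n) powr \<alpha> * g n j (U' v) \<le> ((real j - 1) * d n) powr \<alpha> * g n j (U' v)"
          proof (cases "g n j (U' v) = 0")
            case False
            then have "U' v < (real j + 1) * d n"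
              using gz[of "U' v" j n] by force
            then have "max 0 (U' v - 2 * d n) \<le> (real j - 1) * d n"
              using d0[of n] j by (intro max.boundedI mult_nonneg_nonneg) (auto simp: algebra_simps)
            then show ?thesis
              using assms(1) by (intro mult_right_mono powr_mono2 g0) auto
          qed simp
        qed
        finally show "max 0 (U' v - 2 * d n) powr \<alpha>
          \<le> (\<Sum>j\<in>{2..m n}. ((real j - 1) * d n) powr \<alpha> * g n j (U' v))" .
      qed (use intg intp in auto)
      also have "\<dots> = l n"
        unfolding l_def using intg by simp
      finally show ?thesis .
    qed
    have dl: "d \<longlonglongrightarrow> 0"
      unfolding d_def using LIMSEQ_inverse_real_of_nat by (simp add: field_simps inverse_eq_divide)
    have up_lim: "(\<lambda>n. \<integral>v. (U' v + 2 * d n) powr \<alpha> \<partial>N) \<longlonglongrightarrow> (\<integral>v. U' v powr \<alpha> \<partial>N)"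
    proof (rule integral_dominated_convergence[where w="\<lambda>_. (c + 2) powr \<alpha>"])
      show "AE v in N. (\<lambda>n. (U' v + 2 * d n) powr \<alpha>) \<longlonglongrightarrow> U' v powr \<alpha>"
        using dl U'0 d0 assms(1)
        by (intro AE_I2 tendsto_powr2[of _ _ _ _ \<alpha>]) (auto intro!: tendsto_eq_intros always_eventually add_nonneg_nonneg simp: less_imp_le)
      show "AE v in N. norm ((U' v + 2 * d n) powr \<alpha>) \<le> (c + 2) powr \<alpha>" for n
        using U'0 U'c d0[of n] assms(1) by (auto intro!: AE_I2 powr_mono2 add_mono add_nonneg_nonneg)
    qed auto
    have low_lim: "(\<lambda>n. \<integral>v. max 0 (U' v - 2 * d n) powr \<alpha> \<partial>N) \<longlonglongrightarrow> (\<integral>v. U' v powr \<alpha> \<partial>N)"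
    proof (rule integral_dominated_convergence[where w="\<lambda>_. c powr \<alpha>"])
      show "AE v in N. (\<lambda>n. max 0 (U' v - 2 * d n) powr \<alpha>) \<longlonglongrightarrow> U' v powr \<alpha>"
      proof (rule AE_I2)
        fix v
        have "(\<lambda>n. max 0 (U' v - 2 * d n)) \<longlonglongrightarrow> max 0 (U' v - 2 * 0)"
          by (intro tendsto_intros dl)
        then show "(\<lambda>n. max 0 (U' v - 2 * d n) powr \<alpha>) \<longlonglongrightarrow> U' v powr \<alpha>"
          using U'0[of v] assms(1)
          by (intro tendsto_powr2[of _ _ _ _ \<alpha>]) (auto)
      qed
      show "AE v in N. norm (max 0 (U' v - 2 * d n) powr \<alpha>) \<le> c powr \<alpha>" for n
        using assms(1) shrink[of _ n] by (auto intro!: AE_I2 powr_mono2)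
    qed auto
    have sandwich: "\<forall>\<^sub>F x in at_top. lo n x \<le> prob {w \<in> space M. x < R w * U w} / t x
        \<and> prob {w \<in> space M. x < R w * U w} / t x \<le> hi n x" for n
      using eventually_gt_at_top[of 0]
    proof eventually_elim
      fix x :: real assume x: "0 < x"
      have intI: "integrable M (\<lambda>w. indicator {w \<in> space M. x / r < R w} w * g n j (U w))" for r j
        by (rule integrable_const_bound[of _ 1]) (auto simp: g0 g1 split: split_indicator)
      have P: "prob {w \<in> space M. x < R w * U w} = (\<integral>w. indicator {w \<in> space M. x < R w * U w} w \<partial>M)"
        by simp
      have intJ: "integrable M (indicator {w \<in> space M. x < R w * U w} :: _ \<Rightarrow> real)"
        by (rule integrable_const_bound[of _ 1]) auto
      have part: "(\<Sum>j\<le>m n. indicator A w * g n j (U w)) = (indicator A w :: real)" for A w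
        using gs[of "U w" n] U0 Uc by (simp flip: sum_distrib_left)
      have lo': "lo n x = (\<integral>w. (\<Sum>j\<in>{2..m n}. indicator {w \<in> space M. x / ((real j - 1) * d n) < R w} w * g n j (U w)) \<partial>M) / t x"
        unfolding lo_def E_def by (subst Bochner_Integration.integral_sum) (use intI in \<open>auto simp: sum_divide_distrib\<close>)
      have hi': "hi n x = (\<integral>w. (\<Sum>j\<le>m n. indicator {w \<in> space M. x / ((real j + 1) * d n) < R w} w * g n j (U w)) \<partial>M) / t x"
        unfolding hi_def E_def by (subst Bochner_Integration.integral_sum) (use intI in \<open>auto simp: sum_divide_distrib\<close>)
      have t0: "0 \<le> t x"
        by (simp add: t_def)
      have "(\<integral>w. (\<Sum>j\<in>{2..m n}. indicator {w \<in> space M. x / ((real j - 1) * d n) < R w} w * g n j (U w)) \<partial>M)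
        \<le> (\<integral>w. indicator {w \<in> space M. x < R w * U w} w \<partial>M)"
      proof (rule integral_mono)
        fix w assume w: "w \<in> space M"
        have "(\<Sum>j\<in>{2..m n}. indicator {w \<in> space M. x / ((real j - 1) * d n) < R w} w * g n j (U w))
          \<le> (\<Sum>j\<in>{2..m n}. indicator {w \<in> space M. x < R w * U w} w * g n j (U w))"
        proof (rule sum_mono)
          fix j assume j: "j \<in> {2..m n}"
          show "indicator {w \<in> space M. x / ((real j - 1) * d n) < R w} w * g n j (U w)
            \<le> indicator {w \<in> space M. x < R w * U w} w * g n j (U w)"
          proof (cases "g n j (U w) = 0")
            case False
            then have *: "(real j - 1) * d n < U w"
              using gz[of "U w" j n] by force
            have "x < R w * U w" if "x / ((real j - 1) * d n) < R w"
            proof -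
              have "x < R w * ((real j - 1) * d n)"
                using that j d0[of n] by (simp add: field_simps)
              also have "\<dots> \<le> R w * U w"
                using * R0 by (intro mult_left_mono) auto
              finally show ?thesis .
            qed
            then show ?thesis
              using w g0 by (auto split: split_indicator)
          qed simp
        qed
        also have "\<dots> \<le> (\<Sum>j\<le>m n. indicator {w \<in> space M. x < R w * U w} w * g n j (U w))"
          by (intro sum_mono2) (auto simp: g0)
        finally show "(\<Sum>j\<in>{2..m n}. indicator {w \<in> space M. x / ((real j - 1) * d n) < R w} w * g n j (U w))
          \<le> (indicator {w \<in> space M. x < R w * U w} w :: real)"
          by (simp add: part)
      qed (intro Bochner_Integration.integrable_sum intI intJ)+
      then have 1: "lo n x \<le> prob {w \<in> space M. x < R w * U w} / t x"
        unfolding lo' P by (intro divide_right_mono t0)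
      have "(\<integral>w. indicator {w \<in> space M. x < R w * U w} w \<partial>M) \<le>
        (\<integral>w. (\<Sum>j\<le>m n. indicator {w \<in> space M. x / ((real j + 1) * d n) < R w} w * g n j (U w)) \<partial>M)"
      proof (rule integral_mono)
        fix w assume w: "w \<in> space M"
        have "(indicator {w \<in> space M. x < R w * U w} w :: real)
          = (\<Sum>j\<le>m n. indicator {w \<in> space M. x < R w * U w} w * g n j (U w))"
          by (simp add: part)
        also have "\<dots> \<le> (\<Sum>j\<le>m n. indicator {w \<in> space M. x / ((real j + 1) * d n) < R w} w * g n j (U w))"
        proof (rule sum_mono)
          fix j assume j: "j \<in> {..m n}"
          show "indicator {w \<in> space M. x < R w * U w} w * g n j (U w)
            \<le> indicator {w \<in> space M. x / ((real j + 1) * d n) < R w} w * g n j (U w)"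
          proof (cases "g n j (U w) = 0")
            case False
            then have *: "U w < (real j + 1) * d n"
              using gz[of "U w" j n] by force
            have "x / ((real j + 1) * d n) < R w" if "x < R w * U w"
            proof -
              have "x < R w * ((real j + 1) * d n)"
                by (rule less_le_trans[OF that]) (use * R0 in \<open>auto intro!: mult_left_mono\<close>)
              then show ?thesis
                using d0[of n] by (subst pos_divide_less_eq) auto
            qed
            then show ?thesis
              using w g0 by (auto split: split_indicator)
          qed simp
        qed
        finally show "(indicator {w \<in> space M. x < R w * U w} w :: real)
          \<le> (\<Sum>j\<le>m n. indicator {w \<in> space M. x / ((real j + 1) * d n) < R w} w * g n j (U w))" .
      qed (intro Bochner_Integration.integrable_sum intI intJ)+
      then have 2: "prob {w \<in> space M. x < R w * U w} / t x \<le> hi n x"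
        unfolding hi' P by (intro divide_right_mono t0)
      show "lo n x \<le> prob {w \<in> space M. x < R w * U w} / t x
        \<and> prob {w \<in> space M. x < R w * U w} / t x \<le> hi n x"
        using 1 2 by simp
    qed
    show ?thesis
      by (rule tendsto_by_approximation[where lo=lo and hi=hi and l=l and u=u, OF _ low_lim up_lim])
         (use lo_l hi_u low up sandwich in \<open>auto intro!: always_eventually\<close>)
  qed
  then show ?thesis
    by (simp add: t_def)
qed

section \<open>Stationary regularly varying sequences\<close>

lemma integral_uniform_measure:
  fixes g :: "'a \<Rightarrow> real"
  assumes "finite_measure M" and A: "A \<in> sets M" and g: "g \<in> borel_measurable M"
  shows "(\<integral>w. g w \<partial>uniform_measure M A) = (\<integral>w. indicator A w * g w \<partial>M) / measure M A"
proof -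
  interpret finite_measure M by fact
  show ?thesis
  proof (cases "measure M A = 0")
    case True
    then have e: "emeasure M A = 0" by (simp add: emeasure_eq_measure)
    have "emeasure (uniform_measure M A) (space M) = 0"
      using A e by (simp add: sets.Int_space_eq2)
    then have "AE w in uniform_measure M A. g w = 0"
      by (auto intro!: AE_I[where N="space M"])
    then have "(\<integral>w. g w \<partial>uniform_measure M A) = 0"
      by (simp add: integral_eq_zero_AE)
    then show ?thesis using True by simp
  next
    case False
    then have pos: "0 < measure M A"
      by (simp add: zero_less_measure_iff)
    have "uniform_measure M A = density M (\<lambda>w. ennreal (indicator A w / measure M A))"
      unfolding uniform_measure_def
      by (intro density_cong)
         (use A pos divide_ennreal[of 1 "measure M A"] in
           \<open>auto simp: emeasure_eq_measure split: split_indicator\<close>)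
    then show ?thesis
      using A g by (simp add: integral_density)
  qed
qed

lemma measurable_family_vec:
  fixes Z :: "int \<Rightarrow> 'w \<Rightarrow> 'a::euclidean_space"
  assumes "\<And>i. Z i \<in> borel_measurable M"
  shows "(\<lambda>w. family_vec I (\<lambda>i. Z i w)) \<in> borel_measurable M"
  unfolding family_vec_def
  by (rule measurable_coordinatewise_then_product) (use assms in auto)

locale regularly_varying_process = prob_space M
  for M :: "'w measure" +
  fixes X :: "int \<Rightarrow> 'w \<Rightarrow> 'a::euclidean_space" and \<alpha> :: real
    and N :: "'v measure" and \<Theta> :: "int \<Rightarrow> 'v \<Rightarrow> 'a"
  assumes \<alpha>_pos: "0 < \<alpha>"
    and stationary: "strictly_stationary M X"
    and regularly_varying: "regularly_varying_seq M X \<alpha>"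
    and spectral: "spectral_tail_process M X N \<Theta>"
begin

sublocale N: prob_space N
  using spectral by (simp add: spectral_tail_process_def)

lemma X_measurable[measurable]: "X t \<in> borel_measurable M"
  using stationary by (simp add: strictly_stationary_def)

lemma \<Theta>_measurable[measurable]: "\<Theta> t \<in> borel_measurable N"
  using spectral by (simp add: spectral_tail_process_def)

definition tail :: "real \<Rightarrow> real"
  where "tail x = prob {w \<in> space M. x < norm (X 0 w)}"

lemma tail_nonneg: "0 \<le> tail x"
  by (simp add: tail_def)

lemma prob_shift:
  assumes [measurable]: "Measurable.pred (\<Pi>\<^sub>M t\<in>UNIV. borel) P"
  shows "prob {w \<in> space M. P (\<lambda>t. X (t + h) w)} = prob {w \<in> space M. P (\<lambda>t. X t w)}"
proof -
  let ?S = "\<Pi>\<^sub>M t\<in>(UNIV::int set). (borel :: 'a measure)"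
  have *: "measure (distr M ?S (\<lambda>w t. X (t + h) w)) {z \<in> space ?S. P z}
      = prob {w \<in> space M. P (\<lambda>t. X (t + h) w)}" for h
  proof -
    have m: "(\<lambda>w t. X (t + h) w) \<in> measurable M ?S"
      by (rule measurable_PiM_single') auto
    have S: "{z \<in> space ?S. P z} \<in> sets ?S"
      by measurable
    show ?thesis
      unfolding measure_distr[OF m S] by (auto intro!: arg_cong[where f=prob] simp: space_PiM)
  qed
  have "distr M ?S (\<lambda>w t. X (t + h) w) = distr M ?S (\<lambda>w t. X t w)"
    using stationary by (simp add: strictly_stationary_def)
  then show ?thesis
    using *[of h] *[of 0] by simp
qed

text \<open>
  This is the total mass in the regular variation of the single vector \<open>X 1\<close>, transferred to time \<open>0\<close>
  by stationarity.
\<close>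

lemma tail_ratio:
  assumes "0 < u"
  shows "((\<lambda>x. tail (u * x) / tail x) \<longlongrightarrow> u powr (- \<alpha>)) at_top"
proof -
  have "regularly_varying_vec M {1..int 1} X \<alpha>"
    using regularly_varying unfolding regularly_varying_seq_def by blast
  then obtain Q where Q: "prob_space Q" "sets Q = sets borel"
    "weakly_tendsto (angular_tail M {1} X u) (scale_measure (ennreal (u powr (- \<alpha>))) Q) at_top"
    using assms unfolding regularly_varying_vec_def by auto
  have one: "(\<integral>z. (1::real) \<partial>scale_measure (ennreal r) Q') = r * measure Q' (space Q')" if "0 \<le> r"
    for r and Q' :: "(int \<Rightarrow> 'a) measure"
    using that by (simp add: space_scale_measure)
  have shift: "prob {w \<in> space M. x < norm (X 1 w)} = tail x" for x
    using prob_shift[of "\<lambda>z. x < norm (z 0)" 1] by (simp add: tail_def)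
  have norm1: "family_norm {1} z = norm (z 1)" for z :: "int \<Rightarrow> 'a"
    by (simp add: family_norm_def)
  have "(\<integral>z. (1::real) \<partial>angular_tail M {1} X u x) = tail (u * x) / tail x" for x
  proof -
    let ?A = "{w \<in> space M. u * x < norm (X 1 w)}"
    let ?f = "\<lambda>w. family_vec {1} (\<lambda>i. X i w /\<^sub>R norm (X 1 w))"
    have f[measurable]: "?f \<in> borel_measurable M"
      by (intro measurable_family_vec) auto
    have "measure (distr (density M (indicator ?A)) borel ?f) (space (distr (density M (indicator ?A)) borel ?f))
       = measure (density M (indicator ?A)) (space M)"
      using measure_distr[of ?f "density M (indicator ?A)" borel UNIV] f by simp
    also have "emeasure (density M (indicator ?A)) (space M) = (\<integral>\<^sup>+w. indicator ?A w * indicator (space M) w \<partial>M)"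
      by (rule emeasure_density) measurable
    then have "measure (density M (indicator ?A)) (space M)
       = enn2real (\<integral>\<^sup>+w. indicator ?A w * indicator (space M) w \<partial>M)"
      by (simp only: measure_def)
    also have "(\<integral>\<^sup>+w. indicator ?A w * indicator (space M) w \<partial>M) = (\<integral>\<^sup>+w. indicator ?A w \<partial>M)"
      by (intro nn_integral_cong) (auto split: split_indicator)
    also have "\<dots> = emeasure M ?A"
      by (rule nn_integral_indicator) measurable
    also have "enn2real \<dots> = prob ?A"
      by (simp only: measure_def)
    finally show ?thesis
      unfolding angular_tail_def norm1 by (subst one) (auto simp: shift tail_nonneg)
  qed
  moreover have "(\<integral>z. (1::real) \<partial>scale_measure (ennreal (u powr (- \<alpha>))) Q) = u powr (- \<alpha>)"
    using Q(1) by (subst one) (auto simp: prob_space.prob_space)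
  moreover have "((\<lambda>x. \<integral>z. 1 \<partial>angular_tail M {1} X u x)
      \<longlongrightarrow> (\<integral>z. (1::real) \<partial>scale_measure (ennreal (u powr (- \<alpha>))) Q)) at_top"
    using Q(3)[unfolded weakly_tendsto_def, rule_format, of "\<lambda>_. 1"] by simp
  ultimately show ?thesis by (simp only:)
qed

lemma eventually_tail_pos: "\<forall>\<^sub>F x in at_top. 0 < tail x"
proof -
  have "\<forall>\<^sub>F x in at_top. 0 < tail (1 * x) / tail x"
    by (rule order_tendstoD(1)[OF tail_ratio]) auto
  then show ?thesis
    by eventually_elim (use tail_nonneg in \<open>auto simp: less_le split: if_splits\<close>)
qed

lemma spectral_limit:
  fixes G :: "(int \<Rightarrow> 'a) \<Rightarrow> real"
  assumes G: "continuous_on UNIV G" "bounded (range G)"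
  shows "((\<lambda>x. (\<integral>w. indicator {w \<in> space M. x < norm (X 0 w)} w
             * G (family_vec {- int k..int k} (\<lambda>i. X i w /\<^sub>R norm (X 0 w))) \<partial>M) / tail x)
         \<longlongrightarrow> (\<integral>v. G (family_vec {- int k..int k} (\<lambda>i. \<Theta> i v)) \<partial>N)) at_top"
proof -
  have [measurable]: "G \<in> borel_measurable borel"
    using G(1) by (rule borel_measurable_continuous_onI)
  have m1[measurable]: "(\<lambda>w. family_vec {- int k..int k} (\<lambda>i. X i w /\<^sub>R norm (X 0 w))) \<in> borel_measurable M"
    by (intro measurable_family_vec) auto
  have m2[measurable]: "(\<lambda>v. family_vec {- int k..int k} (\<lambda>i. \<Theta> i v)) \<in> borel_measurable N"
    by (intro measurable_family_vec) auto
  have "((\<lambda>x. \<integral>z. G z \<partial>distr (uniform_measure M {w \<in> space M. norm (X 0 w) > x}) borel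
              (\<lambda>w. family_vec {- int k..int k} (\<lambda>i. X i w /\<^sub>R norm (X 0 w))))
        \<longlongrightarrow> (\<integral>z. G z \<partial>distr N borel (\<lambda>v. family_vec {- int k..int k} (\<lambda>i. \<Theta> i v)))) at_top"
    using spectral G unfolding spectral_tail_process_def weakly_tendsto_def by blast
  then show ?thesis
    by (simp add: integral_distr integral_uniform_measure finite_measure_axioms tail_def)
qed

lemma AE_norm_\<Theta>0_le_1: "AE v in N. norm (\<Theta> 0 v) \<le> 1"
proof -
  define G :: "(int \<Rightarrow> 'a) \<Rightarrow> real" where "G z = min 1 (max 0 (norm (z 0) - 1))" for z
  have "continuous_on UNIV G"
    unfolding G_def by (intro continuous_intros continuous_on_product_coordinates)
  moreover have "bounded (range G)"
    unfolding bounded_iff by (rule exI[of _ 1]) (auto simp: G_def)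
  ultimately have "((\<lambda>x. (\<integral>w. indicator {w \<in> space M. x < norm (X 0 w)} w
             * G (family_vec {- int 0..int 0} (\<lambda>i. X i w /\<^sub>R norm (X 0 w))) \<partial>M) / tail x)
         \<longlongrightarrow> (\<integral>v. G (family_vec {- int 0..int 0} (\<lambda>i. \<Theta> i v)) \<partial>N)) at_top"
    by (rule spectral_limit)
  moreover have "G (family_vec {- int 0..int 0} (\<lambda>i. X i w /\<^sub>R norm (X 0 w))) = 0" for w
    by (cases "X 0 w = 0") (simp_all add: G_def family_vec_def)
  ultimately have "((\<lambda>x::real. 0) \<longlongrightarrow> (\<integral>v. min 1 (max 0 (norm (\<Theta> 0 v) - 1)) \<partial>N)) at_top"
    by (simp add: G_def family_vec_def)
  then have "(\<integral>v. min 1 (max 0 (norm (\<Theta> 0 v) - 1)) \<partial>N) = 0"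
    by (simp add: tendsto_const_iff)
  moreover have "integrable N (\<lambda>v. min 1 (max 0 (norm (\<Theta> 0 v) - 1)))"
    by (rule N.integrable_const_bound[of _ 1]) auto
  ultimately have "AE v in N. min 1 (max 0 (norm (\<Theta> 0 v) - 1)) = 0"
    by (subst (asm) integral_nonneg_eq_0_iff_AE) auto
  then show ?thesis
    by eventually_elim (auto simp: min_def max_def split: if_splits)
qed

text \<open>
  With \<open>R = |X\<^sub>0|\<close> and \<open>U = min c (max 0 s)\<close>, where \<open>s\<close> is the sum of the \<open>\<theta>'X\<^sub>i / |X\<^sub>0|\<close>, the event
  on the left is, for \<open>x > 0\<close>, the event \<open>R U > x\<close>. The truncation at \<open>c\<close> both encodes the condition \<open>c |X\<^sub>0| > x\<close> and makes \<open>U\<close>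
  bounded.
\<close>

lemma truncated_sum_tail:
  fixes \<theta> :: 'a
  assumes A: "A \<subseteq> {- int k..int k}" and c: "0 < c"
  shows "((\<lambda>x. prob {w \<in> space M. x < \<theta> \<bullet> (\<Sum>i\<in>A. X i w) \<and> x < c * norm (X 0 w)} / tail x)
     \<longlongrightarrow> (\<integral>v. min c (max 0 (\<Sum>i\<in>A. \<theta> \<bullet> \<Theta> i v)) powr \<alpha> \<partial>N)) at_top"
proof -
  define U where "U w = min c (max 0 (\<Sum>i\<in>A. \<theta> \<bullet> (X i w /\<^sub>R norm (X 0 w))))" for w
  define U' where "U' v = min c (max 0 (\<Sum>i\<in>A. \<theta> \<bullet> \<Theta> i v))" for v
  have [measurable]: "U \<in> borel_measurable M" "U' \<in> borel_measurable N"
    unfolding U_def U'_def by measurable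
  have "((\<lambda>x. prob {w \<in> space M. x < norm (X 0 w) * U w} / prob {w \<in> space M. x < norm (X 0 w)})
           \<longlongrightarrow> (\<integral>v. U' v powr \<alpha> \<partial>N)) at_top"
  proof (rule tail_of_product[where c=c])
    fix g :: "real \<Rightarrow> real" assume g: "continuous_on UNIV g" "bounded (range g)"
    define G :: "(int \<Rightarrow> 'a) \<Rightarrow> real" where "G z = g (min c (max 0 (\<Sum>i\<in>A. \<theta> \<bullet> z i)))" for z
    have "continuous_on UNIV (\<lambda>z::int \<Rightarrow> 'a. min c (max 0 (\<Sum>i\<in>A. \<theta> \<bullet> z i)))"
      by (intro continuous_intros continuous_on_product_coordinates)
    from continuous_on_compose2[OF g(1) this] have "continuous_on UNIV G"
      unfolding G_def by auto
    moreover have "bounded (range G)"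
      by (rule bounded_subset[OF g(2)]) (auto simp: G_def)
    ultimately have *: "((\<lambda>x. (\<integral>w. indicator {w \<in> space M. x < norm (X 0 w)} w
             * G (family_vec {- int k..int k} (\<lambda>i. X i w /\<^sub>R norm (X 0 w))) \<partial>M) / tail x)
         \<longlongrightarrow> (\<integral>v. G (family_vec {- int k..int k} (\<lambda>i. \<Theta> i v)) \<partial>N)) at_top"
      by (rule spectral_limit)
    have fv: "(\<Sum>i\<in>A. \<theta> \<bullet> family_vec {- int k..int k} z i) = (\<Sum>i\<in>A. \<theta> \<bullet> z i)" for z :: "int \<Rightarrow> 'a"
      by (rule sum.cong) (use A in \<open>auto simp: family_vec_def\<close>)
    show "((\<lambda>x. (\<integral>w. indicator {w \<in> space M. x < norm (X 0 w)} w * g (U w) \<partial>M) / prob {w \<in> space M. x < norm (X 0 w)})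
        \<longlongrightarrow> (\<integral>v. g (U' v) \<partial>N)) at_top"
      using * by (simp only: G_def fv U_def U'_def tail_def)
  qed (use tail_ratio[unfolded tail_def] c \<alpha>_pos N.prob_space_axioms in \<open>auto simp: U_def U'_def\<close>)
  moreover have "\<forall>\<^sub>F x in at_top. prob {w \<in> space M. x < norm (X 0 w) * U w}
      = prob {w \<in> space M. x < \<theta> \<bullet> (\<Sum>i\<in>A. X i w) \<and> x < c * norm (X 0 w)}"
    using eventually_gt_at_top[of 0]
  proof eventually_elim
    fix x :: real assume x: "0 < x"
    have "x < norm (X 0 w) * U w \<longleftrightarrow> x < \<theta> \<bullet> (\<Sum>i\<in>A. X i w) \<and> x < c * norm (X 0 w)" for w
    proof (cases "norm (X 0 w) = 0")
      case False
      define r where "r = norm (X 0 w)"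
      have r: "0 < r" using False by (simp add: r_def)
      have "(\<Sum>i\<in>A. \<theta> \<bullet> (X i w /\<^sub>R norm (X 0 w))) = (\<theta> \<bullet> (\<Sum>i\<in>A. X i w)) / r"
        by (simp add: r_def inner_sum_right sum_distrib_left divide_inverse_commute)
      then have "U w = min c (max 0 ((\<theta> \<bullet> (\<Sum>i\<in>A. X i w)) / r))"
        by (simp add: U_def)
      moreover have "r * min c (max 0 (s / r)) = min (c * r) (max 0 s)" for s
      proof -
        have "r * max 0 (s / r) = max 0 s"
          using r by (simp add: max_mult_distrib_left)
        then show ?thesis
          using r by (simp add: min_mult_distrib_left mult.commute)
      qed
      ultimately have "norm (X 0 w) * U w = min (c * r) (max 0 (\<theta> \<bullet> (\<Sum>i\<in>A. X i w)))"
        by (simp add: r_def)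
      then show ?thesis
        using x by (auto simp: r_def)
    qed (use x in auto)
    then show "prob {w \<in> space M. x < norm (X 0 w) * U w}
      = prob {w \<in> space M. x < \<theta> \<bullet> (\<Sum>i\<in>A. X i w) \<and> x < c * norm (X 0 w)}"
      by simp
  qed
  ultimately show ?thesis
    unfolding U'_def tail_def
    by (elim Lim_transform_eventually) (auto elim: eventually_mono)
qed

section \<open>Increments of the tail limits\<close>

lemma tail_limit_scale:
  fixes W :: "'w \<Rightarrow> real"
  assumes "((\<lambda>x. prob {w \<in> space M. x < W w} / tail x) \<longlongrightarrow> b) at_top" and u: "0 < u"
  shows "((\<lambda>x. prob {w \<in> space M. u * x < W w} / tail x) \<longlongrightarrow> b * u powr (- \<alpha>)) at_top"
proof -
  have f: "filterlim (\<lambda>x. u * x) at_top at_top"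
    using filterlim_tendsto_pos_mult_at_top[OF tendsto_const u filterlim_ident] .
  have "\<forall>\<^sub>F x in at_top. 0 < tail (u * x)"
    using eventually_compose_filterlim[OF eventually_tail_pos f] .
  then have "\<forall>\<^sub>F x in at_top. prob {w \<in> space M. u * x < W w} / tail (u * x) * (tail (u * x) / tail x)
      = prob {w \<in> space M. u * x < W w} / tail x"
    by eventually_elim auto
  then show ?thesis
    using tendsto_mult[OF filterlim_compose[OF assms(1) f] tail_ratio[OF u]]
    by (rule Lim_transform_eventually[rotated])
qed

text \<open>
  The difference of positive powers whose mean is the increment \<open>b\<^sub>k\<^sub>+\<^sub>1(\<theta>) - b\<^sub>k(\<theta>)\<close>.
\<close>

definition excess :: "'a \<Rightarrow> nat \<Rightarrow> 'v \<Rightarrow> real"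
  where "excess \<theta> k v = max 0 (\<Sum>i\<in>{0..int k}. \<theta> \<bullet> \<Theta> i v) powr \<alpha>
                  - max 0 (\<Sum>i\<in>{1..int k}. \<theta> \<bullet> \<Theta> i v) powr \<alpha>"

lemma excess_measurable[measurable]: "excess \<theta> k \<in> borel_measurable N"
  unfolding excess_def by measurable

text \<open>
  Write \<open>S\<close> and \<open>S'\<close> for the two sums; they differ by \<open>\<theta>'X\<^sub>0\<close>. If \<open>c |X\<^sub>0| > x\<close>, the spectral tail process
  describes both sums, with limit the truncated mean \<open>a\<close>. If \<open>c |X\<^sub>0| \<le> x\<close>, exactly one of the sums exceeds
  \<open>x\<close> only if \<open>S'\<close> lies within \<open>x / c\<close> of \<open>x\<close>. By the assumption on the tail of \<open>S'\<close>, the weight of this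
  window tends to \<open>b\<close> times \<open>(1 - 1/c) powr (- \<alpha>) - (1 + 1/c) powr (- \<alpha>)\<close>, which vanishes as \<open>c\<close> grows.
  The truncated means converge by dominated convergence, applied to the difference of the two powers,
  for which \<open>H\<close> is a bound uniform in \<open>c\<close>.
\<close>

lemma increment_limit:
  fixes \<theta> :: 'a and H :: "'v \<Rightarrow> real"
  assumes \<theta>: "norm \<theta> = 1"
    and lim: "((\<lambda>x. prob {w \<in> space M. x < \<theta> \<bullet> (\<Sum>i\<in>{1..int k}. X i w)} / tail x) \<longlongrightarrow> b) at_top"
    and H: "integrable N H"
    and env: "\<And>c. 0 < c \<Longrightarrow> AE v in N.
       \<bar>min c (max 0 (\<Sum>i\<in>{0..int k}. \<theta> \<bullet> \<Theta> i v)) powr \<alpha>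
      - min c (max 0 (\<Sum>i\<in>{1..int k}. \<theta> \<bullet> \<Theta> i v)) powr \<alpha>\<bar> \<le> H v"
  shows "((\<lambda>x. prob {w \<in> space M. x < \<theta> \<bullet> (\<Sum>i\<in>{0..int k}. X i w)} / tail x
             - prob {w \<in> space M. x < \<theta> \<bullet> (\<Sum>i\<in>{1..int k}. X i w)} / tail x)
          \<longlongrightarrow> (\<integral>v. excess \<theta> k v \<partial>N)) at_top"
proof -
  define S where "S w = \<theta> \<bullet> (\<Sum>i\<in>{0..int k}. X i w)" for w
  define S' where "S' w = \<theta> \<bullet> (\<Sum>i\<in>{1..int k}. X i w)" for w
  define T where "T v = max 0 (\<Sum>i\<in>{0..int k}. \<theta> \<bullet> \<Theta> i v)" for v
  define T' where "T' v = max 0 (\<Sum>i\<in>{1..int k}. \<theta> \<bullet> \<Theta> i v)" for v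
  have [measurable]: "S \<in> borel_measurable M" "S' \<in> borel_measurable M"
      "T \<in> borel_measurable N" "T' \<in> borel_measurable N"
    unfolding S_def S'_def T_def T'_def by measurable
  have insert_0: "{0..int k} = insert 0 {1..int k}" by auto
  have SS': "\<bar>S w - S' w\<bar> \<le> norm (X 0 w)" for w
  proof -
    have "S w - S' w = \<theta> \<bullet> X 0 w"
      unfolding S_def S'_def insert_0 by (subst sum.insert) (auto simp: inner_add_right)
    then show ?thesis
      using Cauchy_Schwarz_ineq2[of \<theta> "X 0 w"] \<theta> by simp
  qed
  define c where "c n = real n + 2" for n
  have c: "1 < c n" for n by (simp add: c_def)
  \<comment> \<open>\<open>A\<close> is the contribution of large \<open>X\<^sub>0\<close> and \<open>B\<close> the weight of the window around \<open>x\<close>.\<close>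
  define A where "A n x = prob {w \<in> space M. x < S w \<and> x < c n * norm (X 0 w)} / tail x
      - prob {w \<in> space M. x < S' w \<and> x < c n * norm (X 0 w)} / tail x" for n x
  define B where "B n x = prob {w \<in> space M. (1 - 1 / c n) * x < S' w} / tail x
     - prob {w \<in> space M. (1 + 1 / c n) * x < S' w} / tail x" for n x
  define a where "a n = (\<integral>v. min (c n) (T v) powr \<alpha> - min (c n) (T' v) powr \<alpha> \<partial>N)" for n
  define e where "e n = b * (1 - 1 / c n) powr (- \<alpha>) - b * (1 + 1 / c n) powr (- \<alpha>)" for n
  have A: "(A n \<longlongrightarrow> a n) at_top" for n
  proof -
    have c0: "0 < c n" using c[of n] by simp
    have 1: "((\<lambda>x. prob {w \<in> space M. x < S w \<and> x < c n * norm (X 0 w)} / tail x)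
       \<longlongrightarrow> (\<integral>v. min (c n) (T v) powr \<alpha> \<partial>N)) at_top"
      unfolding S_def T_def by (rule truncated_sum_tail[where k=k]) (use c0 in auto)
    have 2: "((\<lambda>x. prob {w \<in> space M. x < S' w \<and> x < c n * norm (X 0 w)} / tail x)
       \<longlongrightarrow> (\<integral>v. min (c n) (T' v) powr \<alpha> \<partial>N)) at_top"
      unfolding S'_def T'_def by (rule truncated_sum_tail[where k=k]) (use c0 in auto)
    have i: "integrable N (\<lambda>v. min (c n) (T v) powr \<alpha>)" "integrable N (\<lambda>v. min (c n) (T' v) powr \<alpha>)"
      by (rule N.integrable_const_bound[of _ "c n powr \<alpha>"];
          use c0 \<alpha>_pos in \<open>auto intro!: AE_I2 powr_mono2 simp: T_def T'_def\<close>)+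
    show ?thesis
      unfolding A_def a_def using tendsto_diff[OF 1 2] i by simp
  qed
  have B: "(B n \<longlongrightarrow> e n) at_top" for n
    unfolding B_def e_def
    by (intro tendsto_diff tail_limit_scale lim[folded S'_def]) (use c[of n] in \<open>auto simp: field_simps\<close>)
  have sandwich: "\<forall>\<^sub>F x in at_top.
     A n x - B n x \<le> prob {w \<in> space M. x < S w} / tail x - prob {w \<in> space M. x < S' w} / tail x
     \<and> prob {w \<in> space M. x < S w} / tail x - prob {w \<in> space M. x < S' w} / tail x \<le> A n x + B n x" for n
    using eventually_gt_at_top[of 0]
  proof eventually_elim
    fix x :: real assume x: "0 < x"
    let ?I = "\<lambda>P w. indicator {w \<in> space M. P w} w :: real"
    let ?d = "\<lambda>w. ?I (\<lambda>w. x < S w) w - ?I (\<lambda>w. x < S' w) w"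
    let ?a = "\<lambda>w. ?I (\<lambda>w. x < S w \<and> x < c n * norm (X 0 w)) w
       - ?I (\<lambda>w. x < S' w \<and> x < c n * norm (X 0 w)) w"
    let ?b = "\<lambda>w. ?I (\<lambda>w. (1 - 1 / c n) * x < S' w) w - ?I (\<lambda>w. (1 + 1 / c n) * x < S' w) w"
    have I: "integrable M (?I P)" if [measurable]: "Measurable.pred M P" for P
      by (rule integrable_const_bound[of _ 1]) auto
    have P: "prob {w \<in> space M. P w} = (\<integral>w. ?I P w \<partial>M)" if [measurable]: "Measurable.pred M P" for P
      by simp
    have int: "integrable M ?d" "integrable M ?a" "integrable M ?b"
      by (intro Bochner_Integration.integrable_diff I; measurable)+
    have d: "prob {w \<in> space M. x < S w} - prob {w \<in> space M. x < S' w} = (\<integral>w. ?d w \<partial>M)"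
      by (subst Bochner_Integration.integral_diff) (auto intro!: I)
    have a: "A n x * tail x = (\<integral>w. ?a w \<partial>M)" if "tail x \<noteq> 0"
      using that by (subst Bochner_Integration.integral_diff) (auto intro!: I simp: A_def field_simps)
    have b: "B n x * tail x = (\<integral>w. ?b w \<partial>M)" if "tail x \<noteq> 0"
      using that by (subst Bochner_Integration.integral_diff) (auto intro!: I simp: B_def field_simps)
    have le: "?d w \<le> ?a w + ?b w" "?a w - ?b w \<le> ?d w" for w
    proof -
      have 1: "(1 - 1 / c n) * x \<le> x" "x \<le> (1 + 1 / c n) * x"
        using x c[of n] by (auto simp: field_simps)
      have "?d w \<le> ?a w + ?b w \<and> ?a w - ?b w \<le> ?d w"
      proof (cases "x < c n * norm (X 0 w)")
        case True
        have "0 \<le> ?b w"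
          using 1 by (auto split: split_indicator)
        moreover have "?a w = ?d w"
          using True by (auto split: split_indicator)
        ultimately show ?thesis by simp
      next
        case False
        then have "norm (X 0 w) \<le> x / c n"
          using c[of n] by (simp add: field_simps)
        then have 2: "S w \<le> S' w + x / c n" "S' w \<le> S w + x / c n"
          using SS'[of w] by linarith+
        have 3: "(1 - 1 / c n) * x = x - x / c n" "(1 + 1 / c n) * x = x + x / c n"
          by (auto simp: algebra_simps)
        show ?thesis
          unfolding 3 using 1[unfolded 3] 2 False by (auto split: split_indicator)
      qed
      then show "?d w \<le> ?a w + ?b w" "?a w - ?b w \<le> ?d w" by auto
    qed
    show "A n x - B n x \<le> prob {w \<in> space M. x < S w} / tail x - prob {w \<in> space M. x < S' w} / tail x
     \<and> prob {w \<in> space M. x < S w} / tail x - prob {w \<in> space M. x < S' w} / tail x \<le> A n x + B n x"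
    proof (cases "tail x = 0")
      case True
      then show ?thesis by (simp add: A_def B_def)
    next
      case False
      then have t: "0 < tail x" using tail_nonneg[of x] by simp
      have "(A n x - B n x) * tail x = (\<integral>w. ?a w - ?b w \<partial>M)"
        using a[OF False] b[OF False] int
        by (subst Bochner_Integration.integral_diff) (simp_all add: left_diff_distrib)
      also have "\<dots> \<le> (\<integral>w. ?d w \<partial>M)"
        by (intro integral_mono le Bochner_Integration.integrable_diff int)
      finally have 1: "(A n x - B n x) * tail x \<le> prob {w \<in> space M. x < S w} - prob {w \<in> space M. x < S' w}"
        by (simp only: d)
      have "(\<integral>w. ?d w \<partial>M) \<le> (\<integral>w. ?a w + ?b w \<partial>M)"
        by (intro integral_mono le Bochner_Integration.integrable_add int)
      also have "\<dots> = (A n x + B n x) * tail x"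
        using a[OF False] b[OF False] int
        by (subst Bochner_Integration.integral_add) (simp_all add: distrib_right)
      finally have 2: "prob {w \<in> space M. x < S w} - prob {w \<in> space M. x < S' w} \<le> (A n x + B n x) * tail x"
        by (simp only: d)
      show ?thesis
        using 1 2 t by (simp add: pos_le_divide_eq pos_divide_le_eq flip: diff_divide_distrib)
    qed
  qed
  have ci: "(\<lambda>n. 1 / c n) \<longlonglongrightarrow> 0"
    unfolding c_def using LIMSEQ_ignore_initial_segment[OF lim_1_over_n, of 2] by (simp add: add.commute)
  have e_lim: "e \<longlonglongrightarrow> 0"
  proof -
    have "e \<longlonglongrightarrow> b * (1 - 0) powr (- \<alpha>) - b * (1 + 0) powr (- \<alpha>)"
      unfolding e_def by (intro tendsto_intros ci) auto
    then show ?thesis by simp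
  qed
  have a_lim: "a \<longlonglongrightarrow> (\<integral>v. excess \<theta> k v \<partial>N)"
    unfolding a_def
  proof (rule integral_dominated_convergence[where w=H])
    show "AE v in N. (\<lambda>n. min (c n) (T v) powr \<alpha> - min (c n) (T' v) powr \<alpha>) \<longlonglongrightarrow> excess \<theta> k v"
    proof (rule AE_I2, rule tendsto_eventually)
      fix v
      obtain n0 where n0: "max (T v) (T' v) \<le> real n0"
        using real_arch_simple by blast
      show "\<forall>\<^sub>F n in sequentially. min (c n) (T v) powr \<alpha> - min (c n) (T' v) powr \<alpha> = excess \<theta> k v"
        using eventually_ge_at_top[of n0]
      proof eventually_elim
        fix n assume "n0 \<le> n"
        then have "real n0 \<le> real n" by simp
        then have "T v \<le> c n" "T' v \<le> c n"
          using n0 unfolding c_def by linarith+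
        then show "min (c n) (T v) powr \<alpha> - min (c n) (T' v) powr \<alpha> = excess \<theta> k v"
          by (simp add: excess_def T_def T'_def min_absorb2)
      qed
    qed
    show "AE v in N. norm (min (c n) (T v) powr \<alpha> - min (c n) (T' v) powr \<alpha>) \<le> H v" for n
      using env[of "c n"] c[of n] by (simp add: T_def T'_def)
  qed (use H in auto)
  have "((\<lambda>x. prob {w \<in> space M. x < S w} / tail x - prob {w \<in> space M. x < S' w} / tail x)
     \<longlongrightarrow> (\<integral>v. excess \<theta> k v \<partial>N)) at_top"
  proof (rule tendsto_by_approximation)
    show "\<forall>\<^sub>F n in sequentially. ((\<lambda>x. A n x - B n x) \<longlongrightarrow> a n - e n) at_top \<and>
      ((\<lambda>x. A n x + B n x) \<longlongrightarrow> a n + e n) at_top \<and> a n - e n \<le> a n - e n \<and> a n + e n \<le> a n + e n \<and>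
      (\<forall>\<^sub>F x in at_top. A n x - B n x \<le> prob {w \<in> space M. x < S w} / tail x - prob {w \<in> space M. x < S' w} / tail x
       \<and> prob {w \<in> space M. x < S w} / tail x - prob {w \<in> space M. x < S' w} / tail x \<le> A n x + B n x)"
      by (intro always_eventually allI conjI tendsto_add tendsto_diff A B sandwich) auto
    show "(\<lambda>n. a n - e n) \<longlonglongrightarrow> (\<integral>v. excess \<theta> k v \<partial>N)"
      using tendsto_diff[OF a_lim e_lim] by simp
    show "(\<lambda>n. a n + e n) \<longlonglongrightarrow> (\<integral>v. excess \<theta> k v \<partial>N)"
      using tendsto_add[OF a_lim e_lim] by simp
  qed
  then show ?thesis
    by (simp add: S_def S'_def)
qed

text \<open>
  By stationarity the sums over \<open>{0..k}\<close> and \<open>{1..k + 1}\<close> have the same law. Induction on \<open>k\<close> therefore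
  yields the existence of \<open>b\<^sub>k(\<theta>)\<close> together with its value as a telescoping sum, starting from the empty
  sum, whose tail is zero.
\<close>

lemma tail_limit_increment:
  fixes \<theta> :: 'a and H :: "'v \<Rightarrow> real"
  assumes \<theta>: "norm \<theta> = 1" and H: "integrable N H"
    and env: "\<And>c k. 0 < c \<Longrightarrow> AE v in N.
       \<bar>min c (max 0 (\<Sum>i\<in>{0..int k}. \<theta> \<bullet> \<Theta> i v)) powr \<alpha>
      - min c (max 0 (\<Sum>i\<in>{1..int k}. \<theta> \<bullet> \<Theta> i v)) powr \<alpha>\<bar> \<le> H v"
  shows "tail_limit M X (k + 1) \<theta> - tail_limit M X k \<theta> = (\<integral>v. excess \<theta> k v \<partial>N)"
proof -
  have shift: "prob {w \<in> space M. x < \<theta> \<bullet> (\<Sum>i\<in>{1..int (Suc k)}. X i w)}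
     = prob {w \<in> space M. x < \<theta> \<bullet> (\<Sum>i\<in>{0..int k}. X i w)}" for x k
  proof -
    have "(\<Sum>i\<in>{0..int k}. X (i + 1) w) = (\<Sum>i\<in>{1..int (Suc k)}. X i w)" for w
      by (rule sum.reindex_bij_witness[of _ "\<lambda>i. i - 1" "\<lambda>i. i + 1"]) auto
    then show ?thesis
      using prob_shift[of "\<lambda>z. x < \<theta> \<bullet> (\<Sum>i\<in>{0..int k}. z i)" 1] by simp
  qed
  have lim: "((\<lambda>x. prob {w \<in> space M. x < \<theta> \<bullet> (\<Sum>i\<in>{1..int k}. X i w)} / tail x)
      \<longlongrightarrow> (\<Sum>j<k. \<integral>v. excess \<theta> j v \<partial>N)) at_top" for k
  proof (induction k)
    case 0
    have "\<forall>\<^sub>F x in at_top. 0 = prob {w \<in> space M. x < \<theta> \<bullet> (\<Sum>i\<in>{1..int 0}. X i w)} / tail x"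
      using eventually_gt_at_top[of 0] by eventually_elim auto
    then have "((\<lambda>x. prob {w \<in> space M. x < \<theta> \<bullet> (\<Sum>i\<in>{1..int 0}. X i w)} / tail x) \<longlongrightarrow> 0) at_top"
      by (rule Lim_transform_eventually[OF tendsto_const])
    then show ?case by simp
  next
    case (Suc k)
    show ?case
      using tendsto_add[OF increment_limit[OF \<theta> Suc H env] Suc] unfolding shift by (simp add: add.commute)
  qed
  have "tail_limit M X k \<theta> = (\<Sum>j<k. \<integral>v. excess \<theta> j v \<partial>N)" for k
    unfolding tail_limit_def using lim[of k] by (intro tendsto_Lim) (auto simp: tail_def)
  then show ?thesis by simp
qed

end

section \<open>Moments of the spectral tail process\<close>

text \<open>
  The Markov property is stated for conditional probabilities of events. It amounts to an equality of
  two measures on the state space (the law of the next state under the weight \<open>h\<close>), which then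
  integrates arbitrary nonnegative functions.
\<close>

lemma (in prob_space) markov_chain_step:
  fixes \<Phi> :: "int \<Rightarrow> 'a \<Rightarrow> 's" and h :: "'s \<Rightarrow> real" and g :: "'s \<Rightarrow> ennreal"
  assumes mc: "markov_chain M S K \<Phi>" and st: "s \<le> t"
    and h[measurable]: "h \<in> borel_measurable S" and h0: "\<And>y. 0 \<le> h y" and hB: "\<And>y. h y \<le> B"
    and g[measurable]: "g \<in> borel_measurable S"
  shows "(\<integral>\<^sup>+w. ennreal (h (\<Phi> s w)) * g (\<Phi> (t + 1) w) \<partial>M)
       = (\<integral>\<^sup>+w. ennreal (h (\<Phi> s w)) * (\<integral>\<^sup>+z. g z \<partial>K (\<Phi> t w)) \<partial>M)"
proof -
  define F where "F = sigma (space M) {\<Phi> s -` B \<inter> space M | s B. s \<le> t \<and> B \<in> sets S}"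
  have K[measurable]: "K \<in> measurable S (prob_algebra S)" and \<Phi>[measurable]: "\<Phi> t \<in> measurable M S" for t
    using mc by (auto simp: markov_chain_def)
  have Ksub[measurable]: "K \<in> measurable S (subprob_algebra S)"
    using K by (rule measurable_prob_algebraD)
  have gen: "{\<Phi> s -` B \<inter> space M | s B. s \<le> t \<and> B \<in> sets S} \<subseteq> sets M"
    by (auto intro: measurable_sets[OF \<Phi>])
  have gen': "{\<Phi> s -` B \<inter> space M | s B. s \<le> t \<and> B \<in> sets S} \<subseteq> Pow (space M)"
    using gen sets.space_closed by blast
  have spF: "space F = space M"
    and setsF: "sets F = sigma_sets (space M) {\<Phi> s -` B \<inter> space M | s B. s \<le> t \<and> B \<in> sets S}"
    unfolding F_def by (simp_all add: space_measure_of[OF gen'] sets_measure_of[OF gen'])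
  have sub: "subalgebra M F"
    unfolding subalgebra_def spF setsF using sets.sigma_sets_subset[OF gen] by simp
  interpret F: finite_measure_subalgebra M F
    by unfold_locales (rule sub)
  have \<Phi>F: "\<Phi> s \<in> measurable F S"
  proof (rule measurableI)
    show "\<Phi> s w \<in> space S" if "w \<in> space F" for w
      using that measurable_space[OF \<Phi>] by (simp add: spF)
    show "\<Phi> s -` B \<inter> space F \<in> sets F" if "B \<in> sets S" for B
      unfolding spF setsF using st that by (intro sigma_sets.Basic) blast
  qed
  have HF[measurable]: "(\<lambda>w. h (\<Phi> s w)) \<in> borel_measurable F"
    using measurable_compose[OF \<Phi>F h] .
  have B0: "0 \<le> B"
    using order_trans[OF h0 hB] .
  define D where "D = density M (\<lambda>w. ennreal (h (\<Phi> s w)))"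
  have [measurable_cong]: "sets D = sets M" and spD: "space D = space M"
    by (simp_all add: D_def)
  have ne: "space (distr D S (\<Phi> t)) \<noteq> {}"
    using not_empty measurable_space[OF \<Phi>[of t]] by auto
  have "distr D S (\<Phi> (t + 1)) = distr D S (\<Phi> t) \<bind> K"
  proof (rule measure_eqI)
    show "sets (distr D S (\<Phi> (t + 1))) = sets (distr D S (\<Phi> t) \<bind> K)"
      using sets_bind[of "distr D S (\<Phi> t)" K S] ne subprob_measurableD(2)[OF Ksub] by simp
    fix A assume "A \<in> sets (distr D S (\<Phi> (t + 1)))"
    then have A[measurable]: "A \<in> sets S" by simp
    have int: "integrable M (\<lambda>w. h (\<Phi> s w) * indicator A (\<Phi> (t + 1) w))"
      by (rule integrable_const_bound[of _ B])
         (simp_all add: h0 hB B0 split: split_indicator)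
    have ae: "AE w in M. real_cond_exp M F (\<lambda>w. indicator A (\<Phi> (t + 1) w)) w = measure (K (\<Phi> t w)) A"
      using mc A unfolding markov_chain_def F_def by blast
    have 1: "integrable M (\<lambda>w. h (\<Phi> s w) * real_cond_exp M F (\<lambda>w. indicator A (\<Phi> (t + 1) w)) w)"
      and 2: "(\<integral>w. h (\<Phi> s w) * real_cond_exp M F (\<lambda>w. indicator A (\<Phi> (t + 1) w)) w \<partial>M)
        = (\<integral>w. h (\<Phi> s w) * indicator A (\<Phi> (t + 1) w) \<partial>M)"
      by (rule F.real_cond_exp_intg[OF int HF]; measurable)+
    have m[measurable]: "(\<lambda>w. measure (K (\<Phi> t w)) A) \<in> borel_measurable M"
      by measurable
    have ae': "AE w in M. h (\<Phi> s w) * real_cond_exp M F (\<lambda>w. indicator A (\<Phi> (t + 1) w)) w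
        = h (\<Phi> s w) * measure (K (\<Phi> t w)) A"
      using ae by eventually_elim simp
    have int': "integrable M (\<lambda>w. h (\<Phi> s w) * measure (K (\<Phi> t w)) A)"
      by (rule Bochner_Integration.integrable_cong_AE_imp[OF 1 _ ae']) measurable
    have eq: "(\<integral>w. h (\<Phi> s w) * measure (K (\<Phi> t w)) A \<partial>M)
       = (\<integral>w. h (\<Phi> s w) * indicator A (\<Phi> (t + 1) w) \<partial>M)"
      unfolding 2[symmetric] by (rule integral_cong_AE[symmetric, OF _ _ ae']) measurable
    have KA: "emeasure (K y) A = ennreal (measure (K y) A)" if "y \<in> space S" for y
      using measurable_space[OF Ksub that]
      by (simp add: space_subprob_algebra subprob_space_def finite_measure.emeasure_eq_measure)
    have "emeasure (distr D S (\<Phi> (t + 1))) A = (\<integral>\<^sup>+w. indicator A (\<Phi> (t + 1) w) \<partial>D)"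
      by (subst nn_integral_indicator[symmetric], simp, subst nn_integral_distr) auto
    also have "\<dots> = (\<integral>\<^sup>+w. ennreal (h (\<Phi> s w)) * indicator A (\<Phi> (t + 1) w) \<partial>M)"
      unfolding D_def by (subst nn_integral_density) auto
    also have "\<dots> = (\<integral>\<^sup>+w. ennreal (h (\<Phi> s w) * indicator A (\<Phi> (t + 1) w)) \<partial>M)"
      by (intro nn_integral_cong) (simp split: split_indicator)
    also have "\<dots> = ennreal (\<integral>w. h (\<Phi> s w) * indicator A (\<Phi> (t + 1) w) \<partial>M)"
      by (rule nn_integral_eq_integral[OF int]) (use h0 in auto)
    also have "\<dots> = (\<integral>\<^sup>+w. ennreal (h (\<Phi> s w) * measure (K (\<Phi> t w)) A) \<partial>M)"
      unfolding eq[symmetric] by (rule nn_integral_eq_integral[symmetric, OF int']) (use h0 in auto)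
    also have "\<dots> = (\<integral>\<^sup>+w. ennreal (h (\<Phi> s w)) * emeasure (K (\<Phi> t w)) A \<partial>M)"
      using measurable_space[OF \<Phi>] by (intro nn_integral_cong) (simp add: KA ennreal_mult h0)
    also have "\<dots> = (\<integral>\<^sup>+w. emeasure (K (\<Phi> t w)) A \<partial>D)"
      unfolding D_def by (subst nn_integral_density) auto
    also have "\<dots> = (\<integral>\<^sup>+y. emeasure (K y) A \<partial>distr D S (\<Phi> t))"
      by (subst nn_integral_distr) auto
    also have "\<dots> = emeasure (distr D S (\<Phi> t) \<bind> K) A"
      by (rule emeasure_bind[symmetric, OF ne _ A]) (simp add: Ksub)
    finally show "emeasure (distr D S (\<Phi> (t + 1))) A = emeasure (distr D S (\<Phi> t) \<bind> K) A" .
  qed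
  then have "(\<integral>\<^sup>+y. g y \<partial>distr D S (\<Phi> (t + 1))) = (\<integral>\<^sup>+y. g y \<partial>(distr D S (\<Phi> t) \<bind> K))"
    by simp
  also have "\<dots> = (\<integral>\<^sup>+y. \<integral>\<^sup>+z. g z \<partial>K y \<partial>distr D S (\<Phi> t))"
    by (rule nn_integral_bind[OF g]) (simp add: Ksub)
  also have "\<dots> = (\<integral>\<^sup>+w. (\<integral>\<^sup>+z. g z \<partial>K (\<Phi> t w)) \<partial>D)"
    by (subst nn_integral_distr) (auto intro: nn_integral_measurable_subprob_algebra2 
        measurable_compose[OF Ksub nn_integral_measurable_subprob_algebra])
  also have "\<dots> = (\<integral>\<^sup>+w. ennreal (h (\<Phi> s w)) * (\<integral>\<^sup>+z. g z \<partial>K (\<Phi> t w)) \<partial>M)"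
    unfolding D_def by (subst nn_integral_density)
      (auto intro: measurable_compose[OF \<Phi> measurable_compose[OF Ksub nn_integral_measurable_subprob_algebra]])
  also have "(\<integral>\<^sup>+y. g y \<partial>distr D S (\<Phi> (t + 1))) = (\<integral>\<^sup>+w. g (\<Phi> (t + 1) w) \<partial>D)"
    by (subst nn_integral_distr) auto
  also have "\<dots> = (\<integral>\<^sup>+w. ennreal (h (\<Phi> s w)) * g (\<Phi> (t + 1) w) \<partial>M)"
    unfolding D_def by (subst nn_integral_density) auto
  finally show ?thesis .
qed

context regularly_varying_process begin

text \<open>
  The drift condition is iterated under the weight \<open>|X\<^sub>0|\<^sup>-\<^sup>p\<close> on \<open>|X\<^sub>0| > x\<close>. With this normalisation by
  \<open>|X\<^sub>0|\<close> in place of \<open>x\<close> the initial value is at most \<open>c2 * tail x\<close>, without Karamata's theorem on truncated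
  moments, and the additive constant of the drift is suppressed by the factor \<open>x\<^sup>-\<^sup>p\<close>.
\<close>

lemma weighted_drift:
  fixes \<Phi> :: "int \<Rightarrow> 'w \<Rightarrow> 's" and f :: "'s \<Rightarrow> 'a" and V :: "'a \<Rightarrow> real"
  assumes mc: "markov_chain M S K \<Phi>"
    and f[measurable]: "f \<in> borel_measurable S"
    and Xf: "\<And>t w. w \<in> space M \<Longrightarrow> X t w = f (\<Phi> t w)"
    and p: "0 < p" and V[measurable]: "V \<in> borel_measurable borel" and V0: "\<And>x. 0 \<le> V x"
    and c2: "0 < c2" "\<And>x. V x \<le> c2 * norm x powr p"
    and \<beta>: "0 < \<beta>" "\<beta> < 1" and b0: "0 < b0"
    and drift: "\<And>y. y \<in> space S \<Longrightarrow> (\<integral>\<^sup>+z. ennreal (V (f z)) \<partial>K y) \<le> ennreal (\<beta> * V (f y) + b0)"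
    and x: "0 < x"
  shows "(\<integral>\<^sup>+w. ennreal (indicator {u. x < norm u} (X 0 w) * norm (X 0 w) powr (- p)) * ennreal (V (X (int t) w)) \<partial>M)
    \<le> ennreal (tail x * (c2 * \<beta> ^ t + b0 * x powr (- p) / (1 - \<beta>)))"
proof -
  define \<eta> :: "'a \<Rightarrow> real" where "\<eta> u = indicator {u. x < norm u} u * norm u powr (- p)" for u
  have \<eta>m[measurable]: "\<eta> \<in> borel_measurable borel"
    unfolding \<eta>_def by measurable
  have \<eta>0: "0 \<le> \<eta> u" for u by (simp add: \<eta>_def)
  have \<eta>1: "\<eta> u \<le> indicator {u. x < norm u} u * x powr (- p)" for u
    using x p by (auto simp: \<eta>_def split: split_indicator intro!: powr_mono2')
  have \<Phi>[measurable]: "\<Phi> t \<in> measurable M S" for t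
    using mc by (auto simp: markov_chain_def)
  have tail: "(\<integral>\<^sup>+w. indicator {u. x < norm u} (X 0 w) \<partial>M) = ennreal (tail x)"
  proof -
    have "(\<integral>\<^sup>+w. indicator {u. x < norm u} (X 0 w) \<partial>M) = (\<integral>\<^sup>+w. indicator {w \<in> space M. x < norm (X 0 w)} w \<partial>M)"
      by (intro nn_integral_cong) (auto split: split_indicator)
    then show ?thesis
      by (simp add: tail_def emeasure_eq_measure)
  qed
  have mass: "(\<integral>\<^sup>+w. ennreal (\<eta> (X 0 w)) \<partial>M) \<le> ennreal (tail x * x powr (- p))"
  proof -
    have "(\<integral>\<^sup>+w. ennreal (\<eta> (X 0 w)) \<partial>M)
      \<le> (\<integral>\<^sup>+w. ennreal (x powr (- p)) * indicator {u. x < norm u} (X 0 w) \<partial>M)"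
    proof (rule nn_integral_mono)
      fix w
      have "ennreal (\<eta> (X 0 w)) \<le> ennreal (indicator {u. x < norm u} (X 0 w) * x powr (- p))"
        by (rule ennreal_leI[OF \<eta>1])
      then show "ennreal (\<eta> (X 0 w)) \<le> ennreal (x powr (- p)) * indicator {u. x < norm u} (X 0 w)"
        by (cases "x < norm (X 0 w)") (simp_all add: \<eta>_def)
    qed
    also have "\<dots> = ennreal (x powr (- p)) * ennreal (tail x)"
      unfolding tail[symmetric] by (rule nn_integral_cmult) measurable
    finally show ?thesis
      by (simp add: ennreal_mult mult.commute tail_nonneg)
  qed
  have "(\<integral>\<^sup>+w. ennreal (\<eta> (X 0 w)) * ennreal (V (X (int t) w)) \<partial>M)
    \<le> ennreal (tail x * (c2 * \<beta> ^ t + b0 * x powr (- p) / (1 - \<beta>)))"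
  proof (induction t)
    case 0
    have "(\<integral>\<^sup>+w. ennreal (\<eta> (X 0 w)) * ennreal (V (X (int 0) w)) \<partial>M)
       \<le> (\<integral>\<^sup>+w. ennreal c2 * indicator {u. x < norm u} (X 0 w) \<partial>M)"
    proof (rule nn_integral_mono)
      fix w
      have "\<eta> (X 0 w) * V (X 0 w) \<le> c2 * indicator {u. x < norm u} (X 0 w)"
      proof (cases "x < norm (X 0 w)")
        case True
        then have n: "0 < norm (X 0 w)" using x by linarith
        have "norm (X 0 w) powr (- p) * V (X 0 w) \<le> norm (X 0 w) powr (- p) * (c2 * norm (X 0 w) powr p)"
          by (intro mult_left_mono c2) auto
        also have "\<dots> = c2"
          using n by (simp add: powr_minus)
        finally show ?thesis
          using True by (simp add: \<eta>_def)
      qed (simp add: \<eta>_def)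
      then have "ennreal (\<eta> (X 0 w) * V (X 0 w)) \<le> ennreal (c2 * indicator {u. x < norm u} (X 0 w))"
        by (rule ennreal_leI)
      then show "ennreal (\<eta> (X 0 w)) * ennreal (V (X (int 0) w)) \<le> ennreal c2 * indicator {u. x < norm u} (X 0 w)"
        using \<eta>0 V0 by (cases "x < norm (X 0 w)") (simp_all add: ennreal_mult \<eta>_def)
    qed
    also have "\<dots> = ennreal c2 * ennreal (tail x)"
      unfolding tail[symmetric] by (rule nn_integral_cmult) measurable
    also have "\<dots> = ennreal (tail x * c2)"
      using c2(1) by (simp add: ennreal_mult'[symmetric] mult.commute)
    also have "\<dots> \<le> ennreal (tail x * (c2 * \<beta> ^ 0 + b0 * x powr (- p) / (1 - \<beta>)))"
      using \<beta> b0 tail_nonneg by (intro ennreal_leI mult_left_mono) auto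
    finally show ?case .
  next
    case (Suc t)
    have "(\<integral>\<^sup>+w. ennreal (\<eta> (X 0 w)) * ennreal (V (X (int (Suc t)) w)) \<partial>M)
      = (\<integral>\<^sup>+w. ennreal (\<eta> (f (\<Phi> 0 w))) * ennreal (V (f (\<Phi> (int t + 1) w))) \<partial>M)"
      by (intro nn_integral_cong) (simp add: Xf add.commute)
    also have "\<dots> = (\<integral>\<^sup>+w. ennreal (\<eta> (f (\<Phi> 0 w))) * (\<integral>\<^sup>+z. ennreal (V (f z)) \<partial>K (\<Phi> (int t) w)) \<partial>M)"
    proof (rule markov_chain_step[OF mc, where h="\<lambda>y. \<eta> (f y)" and B="x powr (- p)"])
      show "\<eta> (f y) \<le> x powr (- p)" for y
        by (rule order_trans[OF \<eta>1]) (auto split: split_indicator)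
    qed (use \<eta>0 in auto)
    also have "\<dots> \<le> (\<integral>\<^sup>+w. ennreal \<beta> * (ennreal (\<eta> (X 0 w)) * ennreal (V (X (int t) w)))
         + ennreal b0 * ennreal (\<eta> (X 0 w)) \<partial>M)"
    proof (rule nn_integral_mono)
      fix w assume w: "w \<in> space M"
      have "ennreal (\<eta> (f (\<Phi> 0 w))) * (\<integral>\<^sup>+z. ennreal (V (f z)) \<partial>K (\<Phi> (int t) w))
         \<le> ennreal (\<eta> (f (\<Phi> 0 w))) * ennreal (\<beta> * V (f (\<Phi> (int t) w)) + b0)"
        by (intro mult_left_mono drift) (use measurable_space[OF \<Phi> w] in auto)
      also have "\<dots> = ennreal \<beta> * (ennreal (\<eta> (X 0 w)) * ennreal (V (X (int t) w)))
         + ennreal b0 * ennreal (\<eta> (X 0 w))"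
        using w \<beta> b0 V0 \<eta>0
        by (simp add: Xf distrib_left mult_ac flip: ennreal_mult ennreal_plus)
      finally show "ennreal (\<eta> (f (\<Phi> 0 w))) * (\<integral>\<^sup>+z. ennreal (V (f z)) \<partial>K (\<Phi> (int t) w)) \<le> \<dots>" .
    qed
    also have "\<dots> = ennreal \<beta> * (\<integral>\<^sup>+w. ennreal (\<eta> (X 0 w)) * ennreal (V (X (int t) w)) \<partial>M)
       + ennreal b0 * (\<integral>\<^sup>+w. ennreal (\<eta> (X 0 w)) \<partial>M)"
      by (subst nn_integral_add) (auto simp: nn_integral_cmult)
    also have "\<dots> \<le> ennreal \<beta> * ennreal (tail x * (c2 * \<beta> ^ t + b0 * x powr (- p) / (1 - \<beta>)))
       + ennreal b0 * ennreal (tail x * x powr (- p))"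
      by (intro add_mono mult_left_mono Suc mass) auto
    also have "\<dots> = ennreal (\<beta> * (tail x * (c2 * \<beta> ^ t + b0 * x powr (- p) / (1 - \<beta>))) + b0 * (tail x * x powr (- p)))"
      using \<beta> b0 c2 tail_nonneg[of x] by (subst ennreal_plus) (auto simp: ennreal_mult')
    also have "\<beta> * (tail x * (c2 * \<beta> ^ t + b0 * x powr (- p) / (1 - \<beta>))) + b0 * (tail x * x powr (- p))
      = tail x * (c2 * \<beta> ^ Suc t + b0 * x powr (- p) / (1 - \<beta>))"
      using \<beta> by (simp add: field_simps)
    finally show ?case .
  qed
  then show ?thesis
    by (simp add: \<eta>_def)
qed

text \<open>
  The moment passes to the limit in the definition of the spectral tail process after truncation at \<open>n\<close>,
  which makes the test function bounded; monotone convergence removes the truncation.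
\<close>

lemma spectral_moment_bound:
  fixes V :: "'a \<Rightarrow> real"
  assumes p: "0 < p" and V0: "\<And>x. 0 \<le> V x" and V[measurable]: "V \<in> borel_measurable borel"
    and c1: "0 < c1" "\<And>x. c1 * norm x powr p \<le> V x"
    and D: "0 \<le> D" and R: "(R \<longlongrightarrow> 0) at_top"
    and bound: "\<And>x. 0 < x \<Longrightarrow>
      (\<integral>\<^sup>+w. ennreal (indicator {u. x < norm u} (X 0 w) * norm (X 0 w) powr (- p)) * ennreal (V (X (int t) w)) \<partial>M)
       \<le> ennreal (tail x * (D + R x))"
    and R0: "\<And>x. 0 \<le> R x"
  shows "(\<integral>\<^sup>+v. ennreal (norm (\<Theta> (int t) v) powr p) \<partial>N) \<le> ennreal (D / c1)"
proof -
  have trunc: "(\<integral>v. min (real n) (norm (\<Theta> (int t) v)) powr p \<partial>N) \<le> D / c1" for n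
  proof -
    define G :: "(int \<Rightarrow> 'a) \<Rightarrow> real" where "G z = min (real n) (norm (z (int t))) powr p" for z
    have Gc: "continuous_on UNIV G"
      unfolding G_def using p
      by (intro continuous_on_powr' continuous_intros continuous_on_product_coordinates) auto
    have "bounded (range G)"
      unfolding bounded_iff by (rule exI[of _ "real n powr p"]) (use p in \<open>auto simp: G_def intro!: powr_mono2\<close>)
    from spectral_limit[OF Gc this, of t]
    have lim: "((\<lambda>x. (\<integral>w. indicator {w \<in> space M. x < norm (X 0 w)} w
             * min (real n) (norm (X (int t) w /\<^sub>R norm (X 0 w))) powr p \<partial>M) / tail x)
         \<longlongrightarrow> (\<integral>v. min (real n) (norm (\<Theta> (int t) v)) powr p \<partial>N)) at_top"
      by (simp add: G_def family_vec_def)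
    have le: "\<forall>\<^sub>F x in at_top. (\<integral>w. indicator {w \<in> space M. x < norm (X 0 w)} w
             * min (real n) (norm (X (int t) w /\<^sub>R norm (X 0 w))) powr p \<partial>M) / tail x
          \<le> (D + R x) / c1"
      using eventually_gt_at_top[of 0] eventually_tail_pos
    proof eventually_elim
      fix x :: real assume x: "0 < x" and t: "0 < tail x"
      let ?g = "\<lambda>w. indicator {w \<in> space M. x < norm (X 0 w)} w
             * min (real n) (norm (X (int t) w /\<^sub>R norm (X 0 w))) powr p"
      let ?h = "\<lambda>w. indicator {u. x < norm u} (X 0 w) * norm (X 0 w) powr (- p)"
      have "(\<integral>\<^sup>+w. ennreal (?g w) \<partial>M)
        \<le> (\<integral>\<^sup>+w. ennreal (1 / c1) * (ennreal (?h w) * ennreal (V (X (int t) w))) \<partial>M)"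
      proof (rule nn_integral_mono)
        fix w assume w: "w \<in> space M"
        have "?g w \<le> 1 / c1 * (?h w * V (X (int t) w))"
        proof (cases "x < norm (X 0 w)")
          case True
          then have n: "0 < norm (X 0 w)" using x by linarith
          have "min (real n) (norm (X (int t) w /\<^sub>R norm (X 0 w))) powr p
             \<le> (norm (X (int t) w) / norm (X 0 w)) powr p"
            using p by (intro powr_mono2) (auto simp: divide_inverse_commute)
          also have "\<dots> = norm (X 0 w) powr (- p) * norm (X (int t) w) powr p"
            using n by (simp add: powr_divide powr_minus field_simps)
          also have "\<dots> \<le> norm (X 0 w) powr (- p) * (V (X (int t) w) / c1)"
            using c1 by (intro mult_left_mono) (auto simp: field_simps)
          finally show ?thesis
            using True w by (simp add: field_simps)
        qed (use V0 c1 in \<open>auto split: split_indicator\<close>)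
        then have "ennreal (?g w) \<le> ennreal (1 / c1 * (?h w * V (X (int t) w)))"
          by (rule ennreal_leI)
        also have "\<dots> = ennreal (1 / c1) * (ennreal (?h w) * ennreal (V (X (int t) w)))"
          using V0 c1(1) by (subst ennreal_mult, simp, simp, subst ennreal_mult) auto
        finally show "ennreal (?g w) \<le> \<dots>" .
      qed
      also have "\<dots> = ennreal (1 / c1) * (\<integral>\<^sup>+w. (ennreal (?h w) * ennreal (V (X (int t) w))) \<partial>M)"
        by (rule nn_integral_cmult) measurable
      also have "\<dots> \<le> ennreal (1 / c1) * ennreal (tail x * (D + R x))"
        by (intro mult_left_mono bound x) auto
      also have "\<dots> = ennreal (1 / c1 * (tail x * (D + R x)))"
        using c1(1) by (intro ennreal_mult'[symmetric]) auto
      finally have "(\<integral>w. ?g w \<partial>M) \<le> 1 / c1 * (tail x * (D + R x))"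
        by (rule integral_real_bounded[rotated]) (use c1(1) D R0 t in auto)
      then show "(\<integral>w. ?g w \<partial>M) / tail x \<le> (D + R x) / c1"
        using t c1(1) by (simp add: field_simps)
    qed
    have "((\<lambda>x. (D + R x) / c1) \<longlongrightarrow> (D + 0) / c1) at_top"
      using c1(1) by (intro tendsto_intros R) auto
    from tendsto_le[OF _ this lim le] show ?thesis by simp
  qed
  have "(\<lambda>n. \<integral>\<^sup>+v. ennreal (min (real n) (norm (\<Theta> (int t) v)) powr p) \<partial>N)
     \<longlonglongrightarrow> (\<integral>\<^sup>+v. ennreal (norm (\<Theta> (int t) v) powr p) \<partial>N)"
  proof (rule nn_integral_LIMSEQ)
    show "incseq (\<lambda>n v. ennreal (min (real n) (norm (\<Theta> (int t) v)) powr p))"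
      using p by (auto simp: incseq_def le_fun_def intro!: ennreal_leI powr_mono2)
    show "(\<lambda>n. ennreal (min (real n) (norm (\<Theta> (int t) v)) powr p)) \<longlonglongrightarrow> ennreal (norm (\<Theta> (int t) v) powr p)" for v
    proof (rule tendsto_eventually)
      obtain n0 where n0: "norm (\<Theta> (int t) v) \<le> real n0"
        using real_arch_simple by blast
      show "\<forall>\<^sub>F n in sequentially. ennreal (min (real n) (norm (\<Theta> (int t) v)) powr p) = ennreal (norm (\<Theta> (int t) v) powr p)"
        using eventually_ge_at_top[of n0]
      proof eventually_elim
        fix n assume "n0 \<le> n"
        then have "norm (\<Theta> (int t) v) \<le> real n"
          using n0 by linarith
        then show "ennreal (min (real n) (norm (\<Theta> (int t) v)) powr p) = ennreal (norm (\<Theta> (int t) v) powr p)"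
          by (simp add: min_absorb2)
      qed
    qed
  qed measurable
  then show ?thesis
  proof (rule LIMSEQ_le_const2, intro exI allI impI)
    fix n
    have "integrable N (\<lambda>v. min (real n) (norm (\<Theta> (int t) v)) powr p)"
      by (rule N.integrable_const_bound[of _ "real n powr p"]) (use p in \<open>auto intro!: AE_I2 powr_mono2\<close>)
    then have "(\<integral>\<^sup>+v. ennreal (min (real n) (norm (\<Theta> (int t) v)) powr p) \<partial>N)
      = ennreal (\<integral>v. min (real n) (norm (\<Theta> (int t) v)) powr p \<partial>N)"
      by (rule nn_integral_eq_integral) auto
    also have "\<dots> \<le> ennreal (D / c1)"
      by (rule ennreal_leI[OF trunc])
    finally show "(\<integral>\<^sup>+v. ennreal (min (real n) (norm (\<Theta> (int t) v)) powr p) \<partial>N) \<le> ennreal (D / c1)" .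
  qed
qed

text \<open>
  The weights \<open>r\<^sup>-\<^sup>t\<close> with \<open>r = sqrt \<beta>\<close> still leave the moments, which are of order \<open>\<beta>\<^sup>t\<close>, summable with
  ratio \<open>r\<close>, and they grow geometrically, so that the weighted series controls the plain one pointwise.
\<close>

lemma integrable_spectral_envelope:
  assumes p: "0 < p" and \<beta>: "0 < \<beta>" "\<beta> < 1" and C: "0 \<le> C"
    and mom: "\<And>t::nat. (\<integral>\<^sup>+v. ennreal (norm (\<Theta> (int t) v) powr p) \<partial>N) \<le> ennreal (C * \<beta> ^ t)"
  obtains G where "integrable N G"
    "AE v in N. summable (\<lambda>t. norm (\<Theta> (int t) v)) \<and> (\<Sum>t. norm (\<Theta> (int t) v)) powr p \<le> G v"
proof -
  define r where "r = sqrt \<beta>"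
  have r: "0 < r" "r < 1" and rr: "\<beta> = r * r"
    using \<beta> by (auto simp: r_def)
  define G where "G v = (\<Sum>t. ennreal (r powr (- real t) * \<bar>norm (\<Theta> (int t) v)\<bar> powr p))" for v
  have [measurable]: "G \<in> borel_measurable N"
    unfolding G_def by measurable
  have "(\<integral>\<^sup>+v. G v \<partial>N) = (\<Sum>t. \<integral>\<^sup>+v. ennreal (r powr (- real t) * \<bar>norm (\<Theta> (int t) v)\<bar> powr p) \<partial>N)"
    unfolding G_def by (rule nn_integral_suminf) measurable
  also have "\<dots> \<le> (\<Sum>t. ennreal (C * r ^ t))"
  proof (intro suminf_le summableI)
    fix t
    have "(\<integral>\<^sup>+v. ennreal (r powr (- real t) * \<bar>norm (\<Theta> (int t) v)\<bar> powr p) \<partial>N)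
      = ennreal (r powr (- real t)) * (\<integral>\<^sup>+v. ennreal (norm (\<Theta> (int t) v) powr p) \<partial>N)"
      by (simp add: ennreal_mult nn_integral_cmult)
    also have "\<dots> \<le> ennreal (r powr (- real t)) * ennreal (C * \<beta> ^ t)"
      by (intro mult_left_mono mom) auto
    also have "\<dots> = ennreal (r powr (- real t) * (C * \<beta> ^ t))"
      by (intro ennreal_mult'[symmetric]) auto
    also have "r powr (- real t) * (C * \<beta> ^ t) = C * r ^ t"
      using r by (simp add: rr powr_minus powr_realpow power_mult_distrib)
    finally show "(\<integral>\<^sup>+v. ennreal (r powr (- real t) * \<bar>norm (\<Theta> (int t) v)\<bar> powr p) \<partial>N) \<le> ennreal (C * r ^ t)" .
  qed
  also have "\<dots> = ennreal (\<Sum>t. C * r ^ t)"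
    using r C by (intro suminf_ennreal2) (auto intro!: summable_mult summable_geometric)
  also have "\<dots> < \<infinity>" by simp
  finally have fin: "(\<integral>\<^sup>+v. G v \<partial>N) < \<infinity>" .
  then have ae: "AE v in N. G v \<noteq> \<infinity>"
    by (intro nn_integral_PInf_AE) auto
  have int: "integrable N (\<lambda>v. enn2real (G v))"
  proof (rule integrableI_bounded)
    have "(\<integral>\<^sup>+v. ennreal (norm (enn2real (G v))) \<partial>N) \<le> (\<integral>\<^sup>+v. G v \<partial>N)"
      by (intro nn_integral_mono) (simp add: ennreal_enn2real_if)
    then show "(\<integral>\<^sup>+v. ennreal (norm (enn2real (G v))) \<partial>N) < \<infinity>"
      using fin by (rule le_less_trans)
  qed measurable
  have key: "AE v in N. summable (\<lambda>t. norm (\<Theta> (int t) v))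
      \<and> (\<Sum>t. norm (\<Theta> (int t) v)) powr p \<le> enn2real (G v) / (1 - r powr (1 / p)) powr p"
    using ae
  proof eventually_elim
    fix v assume "G v \<noteq> \<infinity>"
    then have *: "(\<Sum>t. ennreal (r powr (- real t) * \<bar>norm (\<Theta> (int t) v)\<bar> powr p)) = ennreal (enn2real (G v))"
      unfolding G_def by (simp add: less_top)
    show "summable (\<lambda>t. norm (\<Theta> (int t) v))
      \<and> (\<Sum>t. norm (\<Theta> (int t) v)) powr p \<le> enn2real (G v) / (1 - r powr (1 / p)) powr p"
      using sum_powr_le_of_weighted_powers[OF r p *] by simp
  qed
  have "integrable N (\<lambda>v. enn2real (G v) / (1 - r powr (1 / p)) powr p)"
    using int by simp
  from that[OF this key] show ?thesis .
qed

section \<open>Convergence of the increments\<close>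

text \<open>
  All partial sums from \<open>0\<close> and from \<open>1\<close> differ by \<open>\<theta>'\<Theta>\<^sub>0\<close>, of modulus at most \<open>1\<close>, and are bounded by the
  sum of the norms. Hence one integrable function dominates the differences of powers for all numbers
  of summands and all truncation levels at once.
\<close>

lemma increments_converge:
  fixes \<theta> :: 'a
  assumes \<theta>: "norm \<theta> = 1" and p: "0 < p" "\<alpha> - 1 < p"
    and G: "integrable N G"
      "AE v in N. summable (\<lambda>t. norm (\<Theta> (int t) v)) \<and> (\<Sum>t. norm (\<Theta> (int t) v)) powr p \<le> G v"
  defines "\<Delta> \<equiv> \<lambda>v. max 0 (\<Sum>t. \<theta> \<bullet> \<Theta> (int t) v) powr \<alpha>
                    - max 0 (\<Sum>t. \<theta> \<bullet> \<Theta> (int (t + 1)) v) powr \<alpha>"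
  shows "AE v in N. summable (\<lambda>t. \<theta> \<bullet> \<Theta> (int t) v)"
    and "integrable N \<Delta>"
    and "(\<lambda>k. tail_limit M X (k + 1) \<theta> - tail_limit M X k \<theta>) \<longlonglongrightarrow> (\<integral>v. \<Delta> v \<partial>N)"
proof -
  define H where "H v = 1 + \<alpha> * (1 + G v)" for v
  define T where "T k v = (\<Sum>i\<in>{0..int k}. \<theta> \<bullet> \<Theta> i v)" for k v
  define T' where "T' k v = (\<Sum>i\<in>{1..int k}. \<theta> \<bullet> \<Theta> i v)" for k v
  have T: "T k v = (\<Sum>j<Suc k. \<theta> \<bullet> \<Theta> (int j) v)" for k v
    unfolding T_def by (rule sum.reindex_bij_witness[of _ int nat]) auto
  have T': "T' k v = (\<Sum>j<k. \<theta> \<bullet> \<Theta> (int (j + 1)) v)" for k v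
    unfolding T'_def by (rule sum.reindex_bij_witness[of _ "\<lambda>j. int (j + 1)" "\<lambda>i. nat i - 1"]) auto
  have TT': "T k v = \<theta> \<bullet> \<Theta> 0 v + T' k v" for k v
    unfolding T T' sum.lessThan_Suc_shift by simp
  have H: "integrable N H"
    unfolding H_def using G(1) by simp
  have inner: "\<bar>\<theta> \<bullet> u\<bar> \<le> norm u" for u
    using Cauchy_Schwarz_ineq2[of \<theta> u] \<theta> by simp
  define dominated where "dominated v \<longleftrightarrow>
     (\<forall>a b k. \<bar>a - b\<bar> \<le> \<bar>T k v - T' k v\<bar> \<and> 0 \<le> a \<and> 0 \<le> b \<and> a \<le> \<bar>T k v\<bar> \<and> b \<le> \<bar>T' k v\<bar> \<longrightarrow>
        \<bar>a powr \<alpha> - b powr \<alpha>\<bar> \<le> H v)" for v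
  have bounds: "AE v in N. dominated v"
    using G(2) AE_norm_\<Theta>0_le_1
  proof eventually_elim
    fix v
    define Y where "Y = (\<Sum>t. norm (\<Theta> (int t) v))"
    assume v: "summable (\<lambda>t. norm (\<Theta> (int t) v)) \<and> (\<Sum>t. norm (\<Theta> (int t) v)) powr p \<le> G v"
      and n0: "norm (\<Theta> 0 v) \<le> 1"
    then have sm: "summable (\<lambda>t. norm (\<Theta> (int t) v))" and Y: "Y powr p \<le> G v"
      by (auto simp: Y_def)
    have "\<bar>T k v\<bar> \<le> Y" for k
    proof -
      have "\<bar>T k v\<bar> \<le> (\<Sum>j<Suc k. norm (\<Theta> (int j) v))"
        unfolding T by (intro order_trans[OF sum_abs] sum_mono inner)
      also have "\<dots> \<le> Y"
        unfolding Y_def by (intro sum_le_suminf sm) auto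
      finally show ?thesis .
    qed
    moreover have "\<bar>T' k v\<bar> \<le> Y" for k
    proof -
      have "\<bar>T' k v\<bar> \<le> (\<Sum>j<k. norm (\<Theta> (int (Suc j)) v))"
        unfolding T' Suc_eq_plus1 by (intro order_trans[OF sum_abs] sum_mono inner)
      also have "\<dots> \<le> (\<Sum>j<Suc k. norm (\<Theta> (int j) v))"
        unfolding sum.lessThan_Suc_shift by simp
      also have "\<dots> \<le> Y"
        unfolding Y_def by (intro sum_le_suminf sm) auto
      finally show ?thesis .
    qed
    moreover have "\<bar>T k v - T' k v\<bar> \<le> 1" for k
      using inner[of "\<Theta> 0 v"] n0 by (simp add: TT')
    ultimately have "\<bar>a powr \<alpha> - b powr \<alpha>\<bar> \<le> 1 + \<alpha> * (1 + Y powr p)"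
      if "\<bar>a - b\<bar> \<le> \<bar>T k v - T' k v\<bar> \<and> 0 \<le> a \<and> 0 \<le> b \<and> a \<le> \<bar>T k v\<bar> \<and> b \<le> \<bar>T' k v\<bar>" for a b k
      using that \<alpha>_pos p by (intro abs_powr_diff_le_envelope) (auto intro: order_trans)
    moreover have "1 + \<alpha> * (1 + Y powr p) \<le> H v"
      using Y \<alpha>_pos by (simp add: H_def)
    ultimately show "dominated v"
      unfolding dominated_def by (blast intro: order_trans)
  qed
  have summ: "summable (\<lambda>t. \<theta> \<bullet> \<Theta> (int t) v)" if "summable (\<lambda>t. norm (\<Theta> (int t) v))" for v
    by (rule summable_comparison_test'[OF that, of 0]) (use inner in auto)
  show "AE v in N. summable (\<lambda>t. \<theta> \<bullet> \<Theta> (int t) v)"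
    using G(2) by eventually_elim (use summ in auto)
  have excess: "excess \<theta> k v = max 0 (T k v) powr \<alpha> - max 0 (T' k v) powr \<alpha>" for k v
    by (simp add: excess_def T_def T'_def)
  have env: "AE v in N. \<bar>min c (max 0 (\<Sum>i\<in>{0..int k}. \<theta> \<bullet> \<Theta> i v)) powr \<alpha>
      - min c (max 0 (\<Sum>i\<in>{1..int k}. \<theta> \<bullet> \<Theta> i v)) powr \<alpha>\<bar> \<le> H v" if c: "0 < c" for c k
    using bounds
  proof eventually_elim
    fix v assume *: "dominated v"
    have "\<bar>min c (max 0 (T k v)) - min c (max 0 (T' k v))\<bar> \<le> \<bar>T k v - T' k v\<bar>"
      "0 \<le> min c (max 0 (T k v))" "0 \<le> min c (max 0 (T' k v))"
      "min c (max 0 (T k v)) \<le> \<bar>T k v\<bar>" "min c (max 0 (T' k v)) \<le> \<bar>T' k v\<bar>"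
      using c by linarith+
    with * have "\<bar>min c (max 0 (T k v)) powr \<alpha> - min c (max 0 (T' k v)) powr \<alpha>\<bar> \<le> H v"
      unfolding dominated_def by blast
    then show "\<bar>min c (max 0 (\<Sum>i\<in>{0..int k}. \<theta> \<bullet> \<Theta> i v)) powr \<alpha>
      - min c (max 0 (\<Sum>i\<in>{1..int k}. \<theta> \<bullet> \<Theta> i v)) powr \<alpha>\<bar> \<le> H v"
      by (simp add: T_def T'_def)
  qed
  have dom: "AE v in N. norm (excess \<theta> k v) \<le> H v" for k
    using bounds
  proof eventually_elim
    fix v assume *: "dominated v"
    have "\<bar>max 0 (T k v) - max 0 (T' k v)\<bar> \<le> \<bar>T k v - T' k v\<bar>"
      "0 \<le> max 0 (T k v)" "0 \<le> max 0 (T' k v)"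
      "max 0 (T k v) \<le> \<bar>T k v\<bar>" "max 0 (T' k v) \<le> \<bar>T' k v\<bar>"
      by linarith+
    with * show "norm (excess \<theta> k v) \<le> H v"
      unfolding dominated_def excess real_norm_def by blast
  qed
  have conv: "AE v in N. (\<lambda>k. excess \<theta> k v) \<longlonglongrightarrow> \<Delta> v"
    using G(2)
  proof eventually_elim
    fix v assume "summable (\<lambda>t. norm (\<Theta> (int t) v)) \<and> (\<Sum>t. norm (\<Theta> (int t) v)) powr p \<le> G v"
    then have sm: "summable (\<lambda>t. \<theta> \<bullet> \<Theta> (int t) v)"
      using summ by blast
    then have sm': "summable (\<lambda>t. \<theta> \<bullet> \<Theta> (int (t + 1)) v)"
      using summable_iff_shift[of "\<lambda>t. \<theta> \<bullet> \<Theta> (int t) v" 1] by simp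
    have "(\<lambda>k. T k v) \<longlonglongrightarrow> (\<Sum>t. \<theta> \<bullet> \<Theta> (int t) v)"
      unfolding T by (rule LIMSEQ_Suc[OF summable_LIMSEQ[OF sm]])
    moreover have "(\<lambda>k. T' k v) \<longlonglongrightarrow> (\<Sum>t. \<theta> \<bullet> \<Theta> (int (t + 1)) v)"
      unfolding T' by (rule summable_LIMSEQ[OF sm'])
    ultimately show "(\<lambda>k. excess \<theta> k v) \<longlonglongrightarrow> \<Delta> v"
      unfolding excess \<Delta>_def using \<alpha>_pos
      by (intro tendsto_diff tendsto_powr2[of _ _ _ _ \<alpha>] tendsto_max tendsto_const)
         (auto intro!: always_eventually)
  qed
  have [measurable]: "\<Delta> \<in> borel_measurable N"
    unfolding \<Delta>_def by measurable
  show "integrable N \<Delta>"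
    by (rule integrable_dominated_convergence[OF _ _ H conv dom]) measurable
  have "(\<lambda>k. \<integral>v. excess \<theta> k v \<partial>N) \<longlonglongrightarrow> (\<integral>v. \<Delta> v \<partial>N)"
    by (rule integral_dominated_convergence[OF _ _ H conv dom]) measurable
  moreover have "tail_limit M X (k + 1) \<theta> - tail_limit M X k \<theta> = (\<integral>v. excess \<theta> k v \<partial>N)" for k
    by (rule tail_limit_increment[OF \<theta> H env])
  ultimately show "(\<lambda>k. tail_limit M X (k + 1) \<theta> - tail_limit M X k \<theta>) \<longlonglongrightarrow> (\<integral>v. \<Delta> v \<partial>N)"
    by (simp only:)
qed

end

theorem theorem3p2:
  fixes M :: "'w measure" and N :: "'v measure" and S :: "'s measure"
    and X :: "int \<Rightarrow> 'w \<Rightarrow> 'a::euclidean_space" and \<Theta> :: "int \<Rightarrow> 'v \<Rightarrow> 'a"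
    and \<Phi> :: "int \<Rightarrow> 'w \<Rightarrow> 's" and K :: "'s \<Rightarrow> 's measure" and f :: "'s \<Rightarrow> 'a"
    and V :: "'a \<Rightarrow> real" and \<alpha> p :: real
  assumes "prob_space M"
    and "\<alpha> > 0"
    and "strictly_stationary M X"
    and "regularly_varying_seq M X \<alpha>"
    and "spectral_tail_process M X N \<Theta>"
    and "markov_chain M S K \<Phi>"
    and "f \<in> borel_measurable S"
    and "\<And>t w. w \<in> space M \<Longrightarrow> X t w = f (\<Phi> t w)"
    and "p > 0" and "\<alpha> - 1 < p" and "p < \<alpha>"
    and "drift_condition S K f p V"
    and "\<exists>B>0. small_set S K {x \<in> space S. V (f x) \<le> B}"
  shows "\<forall>\<theta>::'a. norm \<theta> = 1 \<longrightarrow>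
    (AE v in N. summable (\<lambda>t. \<theta> \<bullet> \<Theta> (int t) v)) \<and>
    integrable N (\<lambda>v. max 0 (\<Sum>t. \<theta> \<bullet> \<Theta> (int t) v) powr \<alpha>
                    - max 0 (\<Sum>t. \<theta> \<bullet> \<Theta> (int (t + 1)) v) powr \<alpha>) \<and>
    (\<lambda>k. tail_limit M X (k + 1) \<theta> - tail_limit M X k \<theta>)
      \<longlonglongrightarrow> (\<integral>v. max 0 (\<Sum>t. \<theta> \<bullet> \<Theta> (int t) v) powr \<alpha>
                    - max 0 (\<Sum>t. \<theta> \<bullet> \<Theta> (int (t + 1)) v) powr \<alpha> \<partial>N)"
proof -
  interpret prob_space M by fact
  interpret regularly_varying_process M X \<alpha> N \<Theta>
    by unfold_locales fact+
  obtain c1 c2 \<beta> b0 where V: "V \<in> borel_measurable borel" "\<And>x. 0 \<le> V x"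
    and c: "0 < c1" "0 < c2" "\<And>x. c1 * norm x powr p \<le> V x" "\<And>x. V x \<le> c2 * norm x powr p"
    and \<beta>: "0 < \<beta>" "\<beta> < 1" "0 < b0"
    and drift: "\<And>y. y \<in> space S \<Longrightarrow> (\<integral>\<^sup>+z. ennreal (V (f z)) \<partial>K y) \<le> ennreal (\<beta> * V (f y) + b0)"
    using assms(12) unfolding drift_condition_def by metis
  have p: "0 < p" by fact
  have mom: "(\<integral>\<^sup>+v. ennreal (norm (\<Theta> (int t) v) powr p) \<partial>N) \<le> ennreal ((c2 / c1) * \<beta> ^ t)" for t
  proof -
    have R: "((\<lambda>x. b0 * x powr (- p) / (1 - \<beta>)) \<longlongrightarrow> 0) at_top"
    proof -
      have "((\<lambda>x. x powr (- p)) \<longlongrightarrow> 0) at_top"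
        using p by (intro tendsto_neg_powr filterlim_ident) auto
      then have "((\<lambda>x. b0 * x powr (- p) / (1 - \<beta>)) \<longlongrightarrow> b0 * 0 / (1 - \<beta>)) at_top"
        using \<beta> by (intro tendsto_intros) auto
      then show ?thesis by simp
    qed
    have "(\<integral>\<^sup>+v. ennreal (norm (\<Theta> (int t) v) powr p) \<partial>N) \<le> ennreal (c2 * \<beta> ^ t / c1)"
      by (rule spectral_moment_bound[OF p V(2,1) c(1,3) _ R weighted_drift[OF assms(6-8) p V c(2,4) \<beta> drift]])
         (use c \<beta> in auto)
    then show ?thesis by simp
  qed
  obtain G where G: "integrable N G"
    "AE v in N. summable (\<lambda>t. norm (\<Theta> (int t) v)) \<and> (\<Sum>t. norm (\<Theta> (int t) v)) powr p \<le> G v"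
    by (rule integrable_spectral_envelope[OF p \<beta>(1,2) _ mom]) (use c in auto)
  show ?thesis
    using increments_converge[OF _ p \<open>\<alpha> - 1 < p\<close> G] by blast
qed

end
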